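(* Let $\tau>0$, $\eta>0$, and let $S^m=\bigcup_{j=1}^N\overline{\sigma_j^m}$ be a connected polygonal (triangulated) surface with boundary polygonal curve $\Gamma^m=\bigcup_{j=1}^{N_\Gamma}\overline{l_j^m}$ lying in the plane $\{x_3=0\}$. Assume that $S^m$ satisfies: (i) $\min_{1\le j\le N}|\sigma_j^m|>0$; (ii) $\dim\{\mathbf n_{\Gamma,j}^m\}_{j=1}^{N_\Gamma}=2$ (dimension of the linear span); (iii) there exists a vertex $\mathbf q^m_{k_0}$ on the polygonal curve $\Gamma^m$ such that the weighted normal $\boldsymbol\omega_{k_0}^m=(w_{k_0,1}^m,w_{k_0,2}^m,w_{k_0,3}^m)^T$ satisfies $(w_{k_0,1}^m)^2+(w_{k_0,2}^m)^2>0$. If $\cos\theta_Y=0$, i.e. $\theta_Y=\frac\pi2$, then the following linear system admits a unique solution $(\mathbf X^{m+1},\mathcal H^{m+1})\in\mathbb X^m\times\mathbb M^m$: $$\Bigl(\tfrac{\mathbf X^{m+1}-\mathbf X^m}{\tau},\mathbf n^m\psi^h\Bigr)^h_{S^m}+\bigl(\nabla_s\mathcal H^{m+1},\nabla_s\psi^h\bigr)_{S^m}=0\qquad\forall\,\psi^h\in\mathbb M^m,$$ $$\bigl(\mathcal H^{m+1}\mathbf n^m,\boldsymbol g^h\bigr)^h_{S^m}-\bigl(\nabla_s\mathbf X^{m+1},\nabla_s\boldsymbol g^h\bigr)_{S^m}+\cos\theta_Y\bigl(\mathbf n_\Gamma^{m+\frac12},\boldsymbol g^h\bigr)_{\Gamma^m}-\frac1{\eta\tau}\bigl((\mathbf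 X_\Gamma^{m+1}-\mathbf X_\Gamma^m)\cdot\mathbf n_\Gamma^m,\boldsymbol g^h\cdot\mathbf n_\Gamma^m\bigr)_{\Gamma^m}=0\qquad\forall\,\boldsymbol g^h\in\mathbb X^m.$$
   Context: Mesh. $S^m\subset\mathbb R^3$ is a polygonal surface consisting of $N$ mutually disjoint (open) triangles $\sigma_j^m$ with vertices $\mathbf q_{j_1}^m,\mathbf q_{j_2}^m,\mathbf q_{j_3}^m$ (ordered anticlockwise on the outer side of $S^m$) forming a triangulation with vertices $\{\mathbf q_k^m\}_{k=1}^K$. $|\sigma_j^m|$ is the area of $\sigma_j^m$. Its boundary $\Gamma^m$ is a closed, positively oriented polygonal curve with segments $l_j^m=[\mathbf p_{j_1}^m,\mathbf p_{j_2}^m]$, $1\le j\le N_\Gamma$, in the plane $\{x_3=0\}$. $\mathbf e_z=(0,0,1)^T$. Normals. $\mathbf n^m$ is piecewise constant, equal on $\sigma_j^m$ to $\mathbf n_j^m=\frac{(\mathbf q_{j_2}^m-\mathbf q_{j_1}^m)\times(\mathbf q_{j_3}^m-\mathbf q_{j_1}^m)}{\|(\mathbf q_{j_2}^m-\mathbf q_{j_1}^m)\times(\mathbf q_{j_3}^m-\mathbf q_{j_1}^m)\|}$; $\mathbf n_\Gamma^m$ is piecewise constant on $\Gamma^m$, equal on $l_j^m$ to $\mathbf n_{\Gamma,j}^m=\frac{(\mathbf p_{j_2}^m-\mathbf p_{j_1}^m)\times\mathbf e_z}{\|(\mathbf p_{j_2}^m-\mathbf p_{j_1}^m)\times\mathbf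 e_z\|}$. The weighted normal at vertex $\mathbf q_k^m$ is $\boldsymbol\omega_k^m=\bigl(\sum_{j\in\mathcal J_k^m}|\sigma_j^m|\bigr)^{-1}\sum_{j\in\mathcal J_k^m}|\sigma_j^m|\,\mathbf n_j^m$, where $\mathcal J_k^m=\{1\le j\le N:\mathbf q_k^m\in\overline{\sigma_j^m}\}$. Spaces. $\mathbb M^m$ is the space of continuous real functions on $S^m$ that are affine on each $\sigma_j^m$; $\mathbb M_0^m\subset\mathbb M^m$ consists of those vanishing on $\Gamma^m$; $\mathbb X^m=\mathbb M^m\times\mathbb M^m\times\mathbb M^m_0$. $\mathbf X^m\in\mathbb X^m$ is the identity function on $S^m$; $\mathbf X_\Gamma^m,\mathbf X_\Gamma^{m+1}$ are the restrictions of $\mathbf X^m,\mathbf X^{m+1}$ to $\Gamma^m$. Products. $(\cdot,\cdot)_{S^m}$ and $(\cdot,\cdot)_{\Gamma^m}$ are the $L^2$ inner products over $S^m$ (area) and $\Gamma^m$ (arc length), using dot products for vectors and Frobenius products for matrices; $\nabla_s$ is the (piecewise) surface gradient on $S^m$, $\nabla_sf=(\mathbb I-\mathbf n^m\otimes\mathbf n^m)\nabla f$, componentwise for vectors. The mass-lumped product is $(f,g)^h_{S^m}=\frac13\sum_{j=1}^N\sum_{k=1}^3|\sigma_j^m|\,f((\mathbf q_{j_k}^m)^-)\cdot g((\mathbf q_{j_k}^m)^-)$, where $f((\mathbf q_{j_k}^m)^-)$ is the limit of $f$ at $\mathbf q_{j_k}^m$ from within $\sigma_j^m$. Finally $\mathbf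 n_\Gamma^{m+\frac12}=\frac12(\partial_s\mathbf X_\Gamma^m+\partial_s\mathbf X_\Gamma^{m+1})\times\mathbf e_z$, with $s$ the arc length parameter of $\Gamma^m$. *)

theory Defs
  imports "HOL-Analysis.Analysis"
begin

section \<open>Triangulated surfaces\<close>

text \<open>
  Vertices, triangles and boundary segments are numbered from 1. \<open>tri M j k\<close> with \<open>k \<in> {1..3}\<close> is the
  index of the \<open>k\<close>-th vertex of triangle \<open>j\<close>; \<open>seg M j 1\<close> and \<open>seg M j 2\<close> are the indices of the
  initial and final point of boundary segment \<open>j\<close>. Values outside these ranges are irrelevant.
\<close>

record mesh =
  nvert :: nat
  vert :: "nat \<Rightarrow> real^3"
  ntri :: nat
  tri :: "nat \<Rightarrow> nat \<Rightarrow> nat"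
  nseg :: nat
  seg :: "nat \<Rightarrow> nat \<Rightarrow> nat"

definition tri_pt :: "mesh \<Rightarrow> nat \<Rightarrow> nat \<Rightarrow> real^3" where
  "tri_pt M j k = vert M (tri M j k)"

definition seg_pt :: "mesh \<Rightarrow> nat \<Rightarrow> nat \<Rightarrow> real^3" where
  "seg_pt M j i = vert M (seg M j i)"

definition open_tri :: "mesh \<Rightarrow> nat \<Rightarrow> (real^3) set" where
  "open_tri M j = rel_interior (convex hull (tri_pt M j ` {1..3}))"

definition open_seg :: "mesh \<Rightarrow> nat \<Rightarrow> (real^3) set" where
  "open_seg M j = open_segment (seg_pt M j 1) (seg_pt M j 2)"

definition surf :: "mesh \<Rightarrow> (real^3) set" where
  "surf M = (\<Union>j\<in>{1..ntri M}. closure (open_tri M j))"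

definition bcurve :: "mesh \<Rightarrow> (real^3) set" where
  "bcurve M = (\<Union>j\<in>{1..nseg M}. closed_segment (seg_pt M j 1) (seg_pt M j 2))"

definition dir_edges :: "mesh \<Rightarrow> nat \<Rightarrow> (nat \<times> nat) set" where
  "dir_edges M j = {(tri M j 1, tri M j 2), (tri M j 2, tri M j 3), (tri M j 3, tri M j 1)}"

definition edges :: "mesh \<Rightarrow> nat \<Rightarrow> nat set set" where
  "edges M j = (\<lambda>(a, b). {a, b}) ` dir_edges M j"

definition boundary_edges :: "mesh \<Rightarrow> nat set set" where
  "boundary_edges M = {e. \<exists>!j. j \<in> {1..ntri M} \<and> e \<in> edges M j}"

definition top_surface_with_boundary :: "'a::topological_space set \<Rightarrow> bool" where
  "top_surface_with_boundary S \<longleftrightarrow>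
     (\<forall>x\<in>S. \<exists>U. \<exists>W :: (real^2) set.
        openin (top_of_set S) U \<and> x \<in> U \<and>
        openin (top_of_set {z. 0 \<le> z$2}) W \<and> U homeomorphic W)"

text \<open>
  Two triangles meet in the face spanned by their common vertices (no hanging nodes). The choice of an
  outer side, as seen from which every triangle is ordered anticlockwise, is encoded combinatorially:
  neighbouring triangles traverse their common edge in opposite directions.
\<close>

definition triangulation :: "mesh \<Rightarrow> bool" where
  "triangulation M \<longleftrightarrow>
     1 \<le> ntri M \<and>
     inj_on (vert M) {1..nvert M} \<and>
     (\<Union>j\<in>{1..ntri M}. tri M j ` {1..3}) = {1..nvert M} \<and>
     disjoint_family_on (open_tri M) {1..ntri M} \<and>
     (\<forall>i\<in>{1..ntri M}. \<forall>j\<in>{1..ntri M}. i \<noteq> j \<longrightarrow>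
        closure (open_tri M i) \<inter> closure (open_tri M j) =
          convex hull (vert M ` (tri M i ` {1..3} \<inter> tri M j ` {1..3}))) \<and>
     disjoint_family_on (dir_edges M) {1..ntri M}"

text \<open>
  The boundary segments are the edges lying in exactly one triangle; suitably enumerated (by \<open>\<pi>\<close>) they
  form a closed polygon in \<open>{x\<^sub>3 = 0}\<close>. Positive orientation means that the enclosed signed area,
  one half of the sum below, is positive.
\<close>

definition boundary_polygon :: "mesh \<Rightarrow> bool" where
  "boundary_polygon M \<longleftrightarrow>
     bij_betw (\<lambda>j. {seg M j 1, seg M j 2}) {1..nseg M} (boundary_edges M) \<and>
     (\<exists>\<pi>. bij_betw \<pi> {1..nseg M} {1..nseg M} \<and>
        (\<forall>i\<in>{1..nseg M}. seg M (\<pi> i) 2 = seg M (\<pi> (i mod nseg M + 1)) 1)) \<and>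
     (\<forall>x\<in>bcurve M. x$3 = 0) \<and>
     0 < (\<Sum>j=1..nseg M. seg_pt M j 1 $ 1 * seg_pt M j 2 $ 2 - seg_pt M j 2 $ 1 * seg_pt M j 1 $ 2)"

definition polygonal_surface :: "mesh \<Rightarrow> bool" where
  "polygonal_surface M \<longleftrightarrow>
     triangulation M \<and> top_surface_with_boundary (surf M) \<and> boundary_polygon M"


section \<open>Integration over the surface and its boundary curve\<close>

text \<open>
  The surface integral over triangle \<open>j\<close> is computed in the affine parametrization by the reference
  triangle, whose area element is the norm of the cross product of its two partial derivatives.
\<close>

definition ref_tri :: "(real \<times> real) set" where
  "ref_tri = {(s, t). 0 < s \<and> 0 < t \<and> s + t < 1}"

definition tri_cross :: "mesh \<Rightarrow> nat \<Rightarrow> real^3" where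
  "tri_cross M j = cross3 (tri_pt M j 2 - tri_pt M j 1) (tri_pt M j 3 - tri_pt M j 1)"

definition tri_param :: "mesh \<Rightarrow> nat \<Rightarrow> real \<times> real \<Rightarrow> real^3" where
  "tri_param M j = (\<lambda>(s, t).
     tri_pt M j 1 + s *\<^sub>R (tri_pt M j 2 - tri_pt M j 1) + t *\<^sub>R (tri_pt M j 3 - tri_pt M j 1))"

definition tri_integral :: "mesh \<Rightarrow> nat \<Rightarrow> (real^3 \<Rightarrow> real) \<Rightarrow> real" where
  "tri_integral M j f = (LINT z:ref_tri|lborel. f (tri_param M j z) * norm (tri_cross M j))"

definition tri_area :: "mesh \<Rightarrow> nat \<Rightarrow> real" where
  "tri_area M j = tri_integral M j (\<lambda>_. 1)"

lemma measure_ref_tri: "measure lborel ref_tri = 1/2"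
proof -
  have eq: "ref_tri = interior (convex hull (insert 0 Basis))"
    by (subst interior_std_simplex) (auto simp: ref_tri_def Basis_prod_def)
  have "measure lebesgue ref_tri = measure lebesgue (convex hull (insert 0 (Basis :: (real \<times> real) set)))"
    unfolding eq by (intro measure_interior negligible_convex_frontier)
      (simp_all add: bounded_convex_hull finite_imp_bounded)
  also have "\<dots> = 1/2"
    using content_std_simplex[where 'a = "real \<times> real"]
    by (subst measure_completion)
      (simp_all add: borel_compact compact_convex_hull finite_imp_compact)
  finally show ?thesis
    by (simp add: eq measure_completion)
qed

lemma tri_area_eq: "tri_area M j = norm (tri_cross M j) / 2"
  by (simp add: tri_area_def tri_integral_def set_lebesgue_integral_def measure_ref_tri)

definition seg_dir :: "mesh \<Rightarrow> nat \<Rightarrow> real^3" where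
  "seg_dir M j = (seg_pt M j 2 - seg_pt M j 1) /\<^sub>R norm (seg_pt M j 2 - seg_pt M j 1)"

definition seg_integral :: "mesh \<Rightarrow> nat \<Rightarrow> (real^3 \<Rightarrow> real) \<Rightarrow> real" where
  "seg_integral M j f =
     (LINT s:{0<..<norm (seg_pt M j 2 - seg_pt M j 1)}|lborel. f (seg_pt M j 1 + s *\<^sub>R seg_dir M j))"

definition surf_prod :: "mesh \<Rightarrow> (real^3 \<Rightarrow> 'a::real_inner) \<Rightarrow> (real^3 \<Rightarrow> 'a) \<Rightarrow> real" where
  "surf_prod M f g = (\<Sum>j=1..ntri M. tri_integral M j (\<lambda>x. f x \<bullet> g x))"

definition bcurve_prod :: "mesh \<Rightarrow> (real^3 \<Rightarrow> 'a::real_inner) \<Rightarrow> (real^3 \<Rightarrow> 'a) \<Rightarrow> real" where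
  "bcurve_prod M f g = (\<Sum>j=1..nseg M. seg_integral M j (\<lambda>x. f x \<bullet> g x))"

definition lumped_prod :: "mesh \<Rightarrow> (real^3 \<Rightarrow> 'a::real_inner) \<Rightarrow> (real^3 \<Rightarrow> 'a) \<Rightarrow> real" where
  "lumped_prod M f g = 1/3 * (\<Sum>j=1..ntri M. \<Sum>k=1..3. tri_area M j *
     (Lim (at (tri_pt M j k) within open_tri M j) f \<bullet>
      Lim (at (tri_pt M j k) within open_tri M j) g))"


section \<open>Normals and derivatives\<close>

text \<open>
  Piecewise defined fields are specified on the open triangles and open segments only; their values on
  the remaining null sets are arbitrary and enter none of the products above.
\<close>

definition tri_at :: "mesh \<Rightarrow> real^3 \<Rightarrow> nat" where
  "tri_at M x = (THE j. j \<in> {1..ntri M} \<and> x \<in> open_tri M j)"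

definition seg_at :: "mesh \<Rightarrow> real^3 \<Rightarrow> nat" where
  "seg_at M x = (THE j. j \<in> {1..nseg M} \<and> x \<in> open_seg M j)"

definition e_z :: "real^3" where
  "e_z = vector [0, 0, 1]"

definition tri_normal :: "mesh \<Rightarrow> nat \<Rightarrow> real^3" where
  "tri_normal M j = tri_cross M j /\<^sub>R norm (tri_cross M j)"

definition seg_normal :: "mesh \<Rightarrow> nat \<Rightarrow> real^3" where
  "seg_normal M j = cross3 (seg_pt M j 2 - seg_pt M j 1) e_z /\<^sub>R
                      norm (cross3 (seg_pt M j 2 - seg_pt M j 1) e_z)"

definition normal :: "mesh \<Rightarrow> real^3 \<Rightarrow> real^3" where
  "normal M x = tri_normal M (tri_at M x)"

definition bnormal :: "mesh \<Rightarrow> real^3 \<Rightarrow> real^3" where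
  "bnormal M x = seg_normal M (seg_at M x)"

definition adjacent_tris :: "mesh \<Rightarrow> nat \<Rightarrow> nat set" where
  "adjacent_tris M k = {j \<in> {1..ntri M}. vert M k \<in> closure (open_tri M j)}"

definition weighted_normal :: "mesh \<Rightarrow> nat \<Rightarrow> real^3" where
  "weighted_normal M k =
     (\<Sum>j\<in>adjacent_tris M k. tri_area M j *\<^sub>R tri_normal M j) /\<^sub>R
     (\<Sum>j\<in>adjacent_tris M k. tri_area M j)"

definition outer_prod :: "real^3 \<Rightarrow> real^3 \<Rightarrow> real^3^3" where
  "outer_prod a b = (\<chi> i j. a$i * b$j)"

text \<open>
  \<open>ambient_grad\<close> picks the gradient of some local extension of \<open>f\<close>: it is determined by \<open>f\<close> on the
  surface up to a normal component, which the projection in \<open>surf_grad\<close> removes.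
\<close>

definition ambient_grad :: "mesh \<Rightarrow> (real^3 \<Rightarrow> real) \<Rightarrow> real^3 \<Rightarrow> real^3" where
  "ambient_grad M f x = (SOME v. (f has_derivative (\<lambda>h. v \<bullet> h)) (at x within surf M))"

definition surf_grad :: "mesh \<Rightarrow> (real^3 \<Rightarrow> real) \<Rightarrow> real^3 \<Rightarrow> real^3" where
  "surf_grad M f x = (mat 1 - outer_prod (normal M x) (normal M x)) *v ambient_grad M f x"

text \<open>Row \<open>i\<close> is the gradient of component \<open>i\<close>; the inner product of \<open>real^3^3\<close> is Frobenius'.\<close>

definition surf_grad_vec :: "mesh \<Rightarrow> (real^3 \<Rightarrow> real^3) \<Rightarrow> real^3 \<Rightarrow> real^3^3" where
  "surf_grad_vec M X x = (\<chi> i. surf_grad M (\<lambda>y. X y $ i) x)"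

definition arc_deriv :: "mesh \<Rightarrow> (real^3 \<Rightarrow> real^3) \<Rightarrow> real^3 \<Rightarrow> real^3" where
  "arc_deriv M X x = vector_derivative (\<lambda>s. X (x + s *\<^sub>R seg_dir M (seg_at M x))) (at 0)"

text \<open>For the traces \<open>X\<^sub>\<Gamma>\<close>, \<open>Y\<^sub>\<Gamma>\<close> of the parametrizations at two consecutive time levels.\<close>

definition bnormal_half :: "mesh \<Rightarrow> (real^3 \<Rightarrow> real^3) \<Rightarrow> (real^3 \<Rightarrow> real^3) \<Rightarrow> real^3 \<Rightarrow> real^3" where
  "bnormal_half M X\<^sub>\<Gamma> Y\<^sub>\<Gamma> x = cross3 ((1/2) *\<^sub>R (arc_deriv M X\<^sub>\<Gamma> x + arc_deriv M Y\<^sub>\<Gamma> x)) e_z"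


section \<open>Finite element spaces\<close>

text \<open>Functions on the surface are extensional, so that equality is equality on the surface.\<close>

definition fe_space :: "mesh \<Rightarrow> (real^3 \<Rightarrow> real) set" where
  "fe_space M = {f \<in> extensional (surf M). continuous_on (surf M) f \<and>
     (\<forall>j\<in>{1..ntri M}. \<exists>a b. \<forall>x\<in>open_tri M j. f x = a \<bullet> x + b)}"

definition fe_space0 :: "mesh \<Rightarrow> (real^3 \<Rightarrow> real) set" where
  "fe_space0 M = {f \<in> fe_space M. \<forall>x\<in>bcurve M. f x = 0}"

definition fe_vec_space :: "mesh \<Rightarrow> (real^3 \<Rightarrow> real^3) set" where
  "fe_vec_space M = {X \<in> extensional (surf M).
     (\<lambda>x\<in>surf M. X x $ 1) \<in> fe_space M \<and>
     (\<lambda>x\<in>surf M. X x $ 2) \<in> fe_space M \<and>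
     (\<lambda>x\<in>surf M. X x $ 3) \<in> fe_space0 M}"

definition surf_id :: "mesh \<Rightarrow> real^3 \<Rightarrow> real^3" where
  "surf_id M = (\<lambda>x\<in>surf M. x)"

definition btrace :: "mesh \<Rightarrow> (real^3 \<Rightarrow> real^3) \<Rightarrow> real^3 \<Rightarrow> real^3" where
  "btrace M X = restrict X (bcurve M)"

end

theory Submission
  imports Defs
begin

text \<open>
  In nodal coordinates the system is a square linear system, so existence follows from uniqueness for the
  homogeneous problem. There the choice \<open>\<psi> = H\<close>, \<open>g = X\<close> makes the lumped terms cancel; hence the surface
  gradients of \<open>X\<close> and \<open>H\<close> and the product \<open>X \<bullet> n\<^sub>\<Gamma>\<close> vanish, and \<open>X\<close> and \<open>H\<close> are constant by connectedness.
  As the boundary normals span the horizontal plane and \<open>X\<^sub>3 = 0\<close> on the boundary, \<open>X = 0\<close>. Testing with the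
  hat function at the vertex \<open>k\<^sub>0\<close> times the horizontal part of the weighted normal then gives \<open>H = 0\<close>.
\<close>

section \<open>Barycentric coordinates\<close>

text \<open>The products are built from limits, integrals and a chosen ambient gradient, from which
  neither linearity nor positivity can be read off. They are therefore reduced to finite sums over
  vertex values (\<open>lumped_normal\<close>, \<open>dirichlet\<close>,
  \<open>bnormal_mass\<close>), where \<open>p1\<close> expresses that a function is determined on
  each closed triangle by its values at the corners. The two equations are merged into one identity,
  \<tau> times the first minus the second, so that the lumped terms enter with opposite signs;
  nothing is lost, since the two test functions vary independently. The assumption on the contact
  angle removes the curve term with \<open>bnormal_half\<close>: its quadratic part in X is a signed
  enclosed area and has no fixed sign, so it would spoil the energy argument. Only the horizontal
  part of the weighted normal can serve as a test direction at the boundary vertex, because the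
  third component of a test field has to vanish there.\<close>

lemma sum_1_3: "(\<Sum>k=1..3. f k) = f 1 + f 2 + f (3::nat)" for f :: "nat \<Rightarrow> 'a::comm_monoid_add"
  by (simp add: eval_nat_numeral add.assoc)

declare One_nat_def [simp del]

lemma one_to_three: "{1..3} = {1, 2, 3::nat}"
  by auto

text \<open>\<open>g2\<close> and \<open>g3\<close> form the basis of the triangle's plane dual to
  the edge vectors \<open>a\<close> and \<open>b\<close>: \<open>cross3 b n\<close> is orthogonal to
  \<open>b\<close> and \<open>n\<close>, and its product with \<open>a\<close> is the triple product
  \<open>n \<bullet> n\<close>. Being tangential, they are already surface gradients. The last
  branch makes the three gradients add up to 0.\<close>

definition bary_grad :: "mesh \<Rightarrow> nat \<Rightarrow> nat \<Rightarrow> real^3" where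
  "bary_grad M j k =
     (let a = tri_pt M j 2 - tri_pt M j 1; b = tri_pt M j 3 - tri_pt M j 1; n = tri_cross M j;
          g2 = cross3 b n /\<^sub>R (n \<bullet> n); g3 = cross3 n a /\<^sub>R (n \<bullet> n)
      in if k = 2 then g2 else if k = 3 then g3 else - (g2 + g3))"

definition bary :: "mesh \<Rightarrow> nat \<Rightarrow> nat \<Rightarrow> real^3 \<Rightarrow> real" where
  "bary M j k x = (if k = 1 then 1 else 0) + bary_grad M j k \<bullet> (x - tri_pt M j 1)"

definition closed_tri :: "mesh \<Rightarrow> nat \<Rightarrow> (real^3) set" where
  "closed_tri M j = convex hull (tri_pt M j ` {1..3})"

lemma closure_open_tri: "closure (open_tri M j) = closed_tri M j"
  by (simp add: open_tri_def closed_tri_def convex_closure_rel_interior compact_convex_hull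
      compact_imp_closed finite_imp_compact)

lemma surf_eq: "surf M = (\<Union>j\<in>{1..ntri M}. closed_tri M j)"
  by (simp add: surf_def closure_open_tri)

lemma sum_bary_grad: "(\<Sum>k=1..3. bary_grad M j k) = 0"
  by (simp add: sum_1_3 bary_grad_def Let_def)

lemma sum_bary: "(\<Sum>k=1..3. bary M j k x) = 1"
proof -
  have "(\<Sum>k=1..3. bary_grad M j k \<bullet> (x - tri_pt M j 1)) = 0"
    unfolding inner_sum_left[symmetric] sum_bary_grad by simp
  then show ?thesis
    by (simp add: bary_def sum_1_3)
qed

lemma bary_grad_orthogonal: "bary_grad M j k \<bullet> tri_cross M j = 0"
  by (simp add: bary_grad_def Let_def inner_add_left inner_diff_left dot_cross_self)

lemma bary_diff: "bary M j k y - bary M j k x = bary_grad M j k \<bullet> (y - x)"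
  by (simp add: bary_def inner_diff_right)

lemma bary_affine: "bary M j k ((1 - s) *\<^sub>R x + s *\<^sub>R y) = (1 - s) * bary M j k x + s * bary M j k y"
  by (simp add: bary_def inner_right_distrib inner_diff_right algebra_simps)

lemma continuous_on_bary [continuous_intros]:
  "continuous_on S f \<Longrightarrow> continuous_on S (\<lambda>x. bary M j k (f x))"
  unfolding bary_def by (intro continuous_intros)

lemma bary_tri_pt:
  assumes "tri_cross M j \<noteq> 0" "k \<in> {1..3}" "l \<in> {1..3}"
  shows "bary M j k (tri_pt M j l) = (if k = l then 1 else 0)"
proof -
  define a where "a = tri_pt M j 2 - tri_pt M j 1"
  define b where "b = tri_pt M j 3 - tri_pt M j 1"
  define n where "n = tri_cross M j"
  have n: "n = cross3 a b"
    by (simp add: n_def a_def b_def tri_cross_def)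
  have "cross3 b n \<bullet> a = n \<bullet> n" "cross3 n a \<bullet> b = n \<bullet> n"
    unfolding n by (simp_all add: cross3_simps)
  moreover have "cross3 b n \<bullet> b = 0" "cross3 n a \<bullet> a = 0"
    by (simp_all add: dot_cross_self)
  moreover have "n \<bullet> n \<noteq> 0"
    using assms(1) by (simp add: n_def)
  ultimately have g23:
    "bary_grad M j 2 \<bullet> a = 1" "bary_grad M j 2 \<bullet> b = 0" "bary_grad M j 3 \<bullet> a = 0" "bary_grad M j 3 \<bullet> b = 1"
    by (simp_all add: bary_grad_def Let_def inner_scaleR_left flip: a_def b_def n_def)
  have "bary_grad M j 1 = - (bary_grad M j 2 + bary_grad M j 3)"
    by (simp add: bary_grad_def Let_def)
  then have g1: "bary_grad M j 1 \<bullet> a = -1" "bary_grad M j 1 \<bullet> b = -1"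
    by (simp_all only: inner_minus_left inner_add_left g23)
  have "k = 1 \<or> k = 2 \<or> k = 3" "l = 1 \<or> l = 2 \<or> l = 3"
    using assms(2,3) by auto
  then show ?thesis
    by (elim disjE; simp add: bary_def g1 g23 flip: a_def b_def)
qed

lemma closed_tri_eq:
  "closed_tri M j = {\<Sum>k=1..3. u k *\<^sub>R tri_pt M j k |u. (\<forall>k\<in>{1..3}. 0 \<le> u k) \<and> sum u {1..3} = 1}"
proof -
  have "tri_pt M j ` {1..3} = {tri_pt M j 1, tri_pt M j 2, tri_pt M j 3}"
    by (auto simp: one_to_three)
  then have "closed_tri M j = {u *\<^sub>R tri_pt M j 1 + v *\<^sub>R tri_pt M j 2 + w *\<^sub>R tri_pt M j 3 | u v w.
      0 \<le> u \<and> 0 \<le> v \<and> 0 \<le> w \<and> u + v + w = 1}"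
    by (simp add: closed_tri_def convex_hull_3)
  also have "\<dots> = {\<Sum>k=1..3. u k *\<^sub>R tri_pt M j k |u. (\<forall>k\<in>{1..3}. 0 \<le> u k) \<and> sum u {1..3} = 1}"
    (is "?L = ?R")
  proof
    show "?L \<subseteq> ?R"
    proof
      fix x assume "x \<in> ?L"
      then obtain u v w where *: "x = u *\<^sub>R tri_pt M j 1 + v *\<^sub>R tri_pt M j 2 + w *\<^sub>R tri_pt M j 3"
        "0 \<le> u" "0 \<le> v" "0 \<le> w" "u + v + w = 1"
        by blast
      show "x \<in> ?R"
        using * by (intro CollectI exI[of _ "\<lambda>k. if k = 1 then u else if k = 2 then v else w"])
          (simp add: sum_1_3 one_to_three)
    qed
    show "?R \<subseteq> ?L"
    proof
      fix x assume "x \<in> ?R"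
      then obtain u :: "nat \<Rightarrow> real" where
        "x = (\<Sum>k=1..3. u k *\<^sub>R tri_pt M j k)" "\<forall>k\<in>{1..3}. 0 \<le> u k" "sum u {1..3} = 1"
        by blast
      then have "x = u 1 *\<^sub>R tri_pt M j 1 + u 2 *\<^sub>R tri_pt M j 2 + u 3 *\<^sub>R tri_pt M j 3"
        "0 \<le> u 1" "0 \<le> u 2" "0 \<le> u 3" "u 1 + u 2 + u 3 = 1"
        by (simp_all add: sum_1_3)
      then show "x \<in> ?L"
        by blast
    qed
  qed
  finally show ?thesis .
qed

lemma bary_convex_comb:
  assumes "tri_cross M j \<noteq> 0" "k \<in> {1..3}" "sum u {1..3} = (1::real)"
  shows "bary M j k (\<Sum>l=1..3. u l *\<^sub>R tri_pt M j l) = u k"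
proof -
  define q where "q = tri_pt M j 1"
  have "(\<Sum>l=1..3. u l *\<^sub>R tri_pt M j l) - q = (\<Sum>l=1..3. u l *\<^sub>R (tri_pt M j l - q))"
    using assms(3) by (simp add: scaleR_diff_right sum_subtractf flip: scaleR_left.sum)
  moreover have "bary_grad M j k \<bullet> (tri_pt M j l - q) =
      (if k = l then 1 else 0) - (if k = 1 then 1 else 0)" if "l \<in> {1..3}" for l
    using bary_tri_pt[OF assms(1,2) that] by (simp add: bary_def q_def)
  ultimately have "bary M j k (\<Sum>l=1..3. u l *\<^sub>R tri_pt M j l) = (if k = 1 then 1 else 0) +
      (\<Sum>l=1..3. u l * ((if k = l then 1 else 0) - (if k = 1 then 1 else 0)))"
    by (simp add: bary_def inner_sum_right flip: q_def)
  also have "\<dots> = u k"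
    using assms(2,3) unfolding sum_1_3 one_to_three by (auto simp: algebra_simps)
  finally show ?thesis .
qed

text \<open>The coordinates are constant along the normal of the triangle; the equation for
  \<open>x\<close> adds that \<open>x\<close> lies in the plane of the triangle.\<close>

lemma closed_tri_bary:
  assumes "tri_cross M j \<noteq> 0"
  shows "x \<in> closed_tri M j \<longleftrightarrow>
    (\<forall>k\<in>{1..3}. 0 \<le> bary M j k x) \<and> x = (\<Sum>k=1..3. bary M j k x *\<^sub>R tri_pt M j k)"
proof
  assume "x \<in> closed_tri M j"
  then obtain u where u: "x = (\<Sum>k=1..3. u k *\<^sub>R tri_pt M j k)" "\<forall>k\<in>{1..3}. 0 \<le> u k" "sum u {1..3} = 1"
    unfolding closed_tri_eq by blast
  have "\<forall>k\<in>{1..3}. bary M j k x = u k"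
    using bary_convex_comb[OF assms _ u(3)] u(1) by simp
  with u show "(\<forall>k\<in>{1..3}. 0 \<le> bary M j k x) \<and> x = (\<Sum>k=1..3. bary M j k x *\<^sub>R tri_pt M j k)"
    by auto
next
  assume "(\<forall>k\<in>{1..3}. 0 \<le> bary M j k x) \<and> x = (\<Sum>k=1..3. bary M j k x *\<^sub>R tri_pt M j k)"
  then show "x \<in> closed_tri M j"
    unfolding closed_tri_eq using sum_bary[of M j x]
    by (intro CollectI exI[of _ "\<lambda>k. bary M j k x"]) simp
qed

lemma inj_on_tri_pt:
  assumes "tri_cross M j \<noteq> 0"
  shows "inj_on (tri_pt M j) {1..3}"
proof
  fix k l assume "k \<in> {1..3::nat}" "l \<in> {1..3::nat}" "tri_pt M j k = tri_pt M j l"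
  then show "k = l"
    using bary_tri_pt[OF assms, of k k] bary_tri_pt[OF assms, of k l] by (auto split: if_splits)
qed

text \<open>An affine dependence \<open>w\<close> has total weight 0 and represents the zero vector.
  Adding it to the weights \<open>e\<close> of the first corner changes neither the point nor the
  total weight, yet shifts coordinate \<open>k\<close> by \<open>w k\<close>, contradicting
  \<open>bary_convex_comb\<close>.\<close>

lemma affine_independent_tri:
  assumes "tri_cross M j \<noteq> 0"
  shows "\<not> affine_dependent (tri_pt M j ` {1..3})"
proof
  assume "affine_dependent (tri_pt M j ` {1..3})"
  then obtain U v where U: "sum U (tri_pt M j ` {1..3}) = 0" "v \<in> tri_pt M j ` {1..3}" "U v \<noteq> 0"
      "(\<Sum>v\<in>tri_pt M j ` {1..3}. U v *\<^sub>R v) = 0"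
    by (auto simp: affine_dependent_explicit_finite)
  define w where "w = U \<circ> tri_pt M j"
  have w: "sum w {1..3} = 0" "(\<Sum>k=1..3. w k *\<^sub>R tri_pt M j k) = 0"
    using U(1,4) by (simp_all add: sum.reindex[OF inj_on_tri_pt[OF assms]] w_def)
  obtain k where k: "k \<in> {1..3}" "w k \<noteq> 0"
    using U(2,3) by (auto simp: w_def)
  define e where "e l = (if l = (1::nat) then 1::real else 0)" for l
  have e: "sum e {1..3} = 1"
    by (simp add: e_def)
  have "bary M j k (\<Sum>l=1..3. e l *\<^sub>R tri_pt M j l) = e k"
    using assms k(1) e by (rule bary_convex_comb)
  moreover have "bary M j k (\<Sum>l=1..3. (e l + w l) *\<^sub>R tri_pt M j l) = e k + w k"
    using assms k(1) e w(1) by (intro bary_convex_comb) (simp_all add: sum.distrib)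
  moreover have "(\<Sum>l=1..3. (e l + w l) *\<^sub>R tri_pt M j l) = (\<Sum>l=1..3. e l *\<^sub>R tri_pt M j l)"
    using w(2) by (simp add: scaleR_add_left sum.distrib)
  ultimately show False
    using k by simp
qed

text \<open>The explicit description of the relative interior of a simplex rests on affine
  independence. Its weights are indexed by points, hence \<open>inv_into\<close> to recover the
  number of a corner.\<close>

lemma open_tri_bary:
  assumes "tri_cross M j \<noteq> 0"
  shows "x \<in> open_tri M j \<longleftrightarrow>
    (\<forall>k\<in>{1..3}. 0 < bary M j k x) \<and> x = (\<Sum>k=1..3. bary M j k x *\<^sub>R tri_pt M j k)"
proof -
  note inj = inj_on_tri_pt[OF assms]
  have rel: "open_tri M j = {y. \<exists>u. (\<forall>x\<in>tri_pt M j ` {1..3}. 0 < u x) \<and>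
      sum u (tri_pt M j ` {1..3}) = 1 \<and> (\<Sum>x\<in>tri_pt M j ` {1..3}. u x *\<^sub>R x) = y}"
    unfolding open_tri_def
    by (rule rel_interior_convex_hull_explicit[OF affine_independent_tri[OF assms]])
  show ?thesis
  proof
    assume "x \<in> open_tri M j"
    then obtain u where u: "\<forall>k\<in>{1..3}. 0 < u (tri_pt M j k)" "(\<Sum>k=1..3. u (tri_pt M j k)) = 1"
       "x = (\<Sum>k=1..3. u (tri_pt M j k) *\<^sub>R tri_pt M j k)"
      unfolding rel by (auto simp: sum.reindex[OF inj] o_def)
    have "\<forall>k\<in>{1..3}. bary M j k x = u (tri_pt M j k)"
      using bary_convex_comb[OF assms _ u(2)] u(3) by simp
    with u show "(\<forall>k\<in>{1..3}. 0 < bary M j k x) \<and> x = (\<Sum>k=1..3. bary M j k x *\<^sub>R tri_pt M j k)"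
      by auto
  next
    assume *: "(\<forall>k\<in>{1..3}. 0 < bary M j k x) \<and> x = (\<Sum>k=1..3. bary M j k x *\<^sub>R tri_pt M j k)"
    define u where "u = (\<lambda>p. bary M j (inv_into {1..3} (tri_pt M j) p) x)"
    have u: "\<forall>k\<in>{1..3}. u (tri_pt M j k) = bary M j k x"
      using inj by (simp add: u_def)
    show "x \<in> open_tri M j"
      unfolding rel
    proof (intro CollectI exI[of _ u] conjI)
      show "\<forall>x\<in>tri_pt M j ` {1..3}. 0 < u x"
        using * u by simp
      show "sum u (tri_pt M j ` {1..3}) = 1"
        using u sum_bary[of M j x] by (simp add: sum.reindex[OF inj])
      have "(\<Sum>x\<in>tri_pt M j ` {1..3}. u x *\<^sub>R x) = (\<Sum>k=1..3. bary M j k x *\<^sub>R tri_pt M j k)"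
        using u by (simp add: sum.reindex[OF inj])
      with * show "(\<Sum>x\<in>tri_pt M j ` {1..3}. u x *\<^sub>R x) = x"
        by argo
    qed
  qed
qed

lemma open_tri_subset: "open_tri M j \<subseteq> closed_tri M j"
  unfolding open_tri_def closed_tri_def by (rule rel_interior_subset)

lemma tri_pt_in_closed_tri: "k \<in> {1..3} \<Longrightarrow> tri_pt M j k \<in> closed_tri M j"
  unfolding closed_tri_def by (blast intro: hull_inc)

lemma closed_closed_tri: "closed (closed_tri M j)"
  by (metis closure_open_tri closed_closure)

lemma tri_param_in_open_tri:
  assumes "tri_cross M j \<noteq> 0" "z \<in> ref_tri"
  shows "tri_param M j z \<in> open_tri M j"
proof -
  obtain s t where z: "z = (s, t)" "0 < s" "0 < t" "s + t < 1"
    using assms(2) by (auto simp: ref_tri_def)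
  define u where "u k = (if k = 1 then 1 - s - t else if k = 2 then s else t)" for k :: nat
  have u: "sum u {1..3} = 1" "\<forall>k\<in>{1..3}. 0 < u k"
    using z by (auto simp: sum_1_3 u_def)
  have x: "tri_param M j z = (\<Sum>l=1..3. u l *\<^sub>R tri_pt M j l)"
    by (simp add: z sum_1_3 u_def tri_param_def algebra_simps)
  have "\<forall>k\<in>{1..3}. bary M j k (tri_param M j z) = u k"
    using bary_convex_comb[OF assms(1) _ u(1)] x by simp
  with u x show ?thesis
    unfolding open_tri_bary[OF assms(1)] by simp
qed

text \<open>The parametrization maps the open reference triangle, of area 1/2, into the open
  triangle, so the values of \<open>f\<close> on the edges do not enter.\<close>

lemma tri_integral_const:
  assumes "tri_cross M j \<noteq> 0" "\<And>x. x \<in> open_tri M j \<Longrightarrow> f x = c"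
  shows "tri_integral M j f = tri_area M j * c"
proof -
  have meas: "ref_tri \<in> sets lborel"
  proof -
    have "ref_tri = {z. 0 < fst z} \<inter> {z. 0 < snd z} \<inter> {z. fst z + snd z < 1}"
      by (auto simp: ref_tri_def)
    also have "open \<dots>"
      by (intro open_Int open_Collect_less continuous_intros)
    finally show ?thesis
      by simp
  qed
  have "tri_integral M j f = (LINT z:ref_tri|lborel. c * norm (tri_cross M j))"
    unfolding tri_integral_def using assms tri_param_in_open_tri[OF assms(1)] meas
    by (intro set_lebesgue_integral_cong) auto
  also have "\<dots> = tri_area M j * c"
    by (simp add: tri_area_eq set_lebesgue_integral_def measure_ref_tri)
  finally show ?thesis .
qed

section \<open>Piecewise affine functions and their surface gradients\<close>

definition local_interp :: "mesh \<Rightarrow> (nat \<Rightarrow> 'a::real_vector) \<Rightarrow> nat \<Rightarrow> real^3 \<Rightarrow> 'a" where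
  "local_interp M v j x = (\<Sum>k=1..3. bary M j k x *\<^sub>R v (tri M j k))"

text \<open>The choice of a triangle can matter only where triangles meet;
  \<open>local_interp_consistent\<close> shows that it does not.\<close>

definition interp :: "mesh \<Rightarrow> (nat \<Rightarrow> 'a::real_vector) \<Rightarrow> real^3 \<Rightarrow> 'a" where
  "interp M v = (\<lambda>x\<in>surf M. local_interp M v (SOME j. j \<in> {1..ntri M} \<and> x \<in> closed_tri M j) x)"

text \<open>Continuous piecewise affine functions in interpolation form. The condition is imposed on
  closed triangles, so continuity across common edges follows (\<open>continuous_on_p1\<close>).
  Values off the surface are left free.\<close>

definition p1 :: "mesh \<Rightarrow> (real^3 \<Rightarrow> 'a::real_vector) \<Rightarrow> bool" where
  "p1 M f \<longleftrightarrow>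
     (\<forall>j\<in>{1..ntri M}. \<forall>x\<in>closed_tri M j. f x = (\<Sum>k=1..3. bary M j k x *\<^sub>R f (tri_pt M j k)))"

definition tri_grad :: "mesh \<Rightarrow> (real^3 \<Rightarrow> real) \<Rightarrow> nat \<Rightarrow> real^3" where
  "tri_grad M f j = (\<Sum>k=1..3. f (tri_pt M j k) *\<^sub>R bary_grad M j k)"

lemma sum_3_delta:
  "k \<in> {1..3} \<Longrightarrow> (\<Sum>l=1..3. (if l = k then 1 else 0) *\<^sub>R f l) = (f (k::nat) :: 'a::real_vector)"
  by (simp add: if_distrib[of "\<lambda>a. a *\<^sub>R _"] cong: if_cong)

lemma p1D:
  "p1 M f \<Longrightarrow> j \<in> {1..ntri M} \<Longrightarrow> x \<in> closed_tri M j \<Longrightarrow>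
    f x = (\<Sum>k=1..3. bary M j k x *\<^sub>R f (tri_pt M j k))"
  by (auto simp: p1_def)

lemma closed_tri_subset_surf: "j \<in> {1..ntri M} \<Longrightarrow> closed_tri M j \<subseteq> surf M"
  by (auto simp: surf_eq)

lemma tri_pt_in_surf: "j \<in> {1..ntri M} \<Longrightarrow> k \<in> {1..3} \<Longrightarrow> tri_pt M j k \<in> surf M"
  using closed_tri_subset_surf tri_pt_in_closed_tri by blast

lemma p1_cong: "(\<And>x. x \<in> surf M \<Longrightarrow> f x = g x) \<Longrightarrow> p1 M f \<longleftrightarrow> p1 M g"
  unfolding p1_def
  by (intro ball_cong arg_cong2[of _ _ _ _ "(=)"] sum.cong refl)
    (use closed_tri_subset_surf tri_pt_in_surf in \<open>auto simp del: atLeastAtMost_iff\<close>)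

lemma p1_linear: "linear T \<Longrightarrow> p1 M f \<Longrightarrow> p1 M (\<lambda>x. T (f x))"
  unfolding p1_def by (simp add: linear_sum linear_cmul del: atLeastAtMost_iff)

lemma p1_diff: "p1 M f \<Longrightarrow> p1 M g \<Longrightarrow> p1 M (\<lambda>x. f x - g x)"
  unfolding p1_def by (auto simp: scaleR_diff_right sum_subtractf simp del: atLeastAtMost_iff)

lemma p1_component:
  fixes X :: "real^3 \<Rightarrow> real^3"
  shows "p1 M X \<longleftrightarrow> (\<forall>i. p1 M (\<lambda>x. X x $ i))"
  unfolding p1_def by (auto simp: vec_eq_iff)

lemma p1_increment:
  assumes "p1 M f" "j \<in> {1..ntri M}" "x \<in> closed_tri M j" "y \<in> closed_tri M j"
  shows "f y - f x = tri_grad M f j \<bullet> (y - x)"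
proof -
  have "f y - f x = (\<Sum>k=1..3. (bary M j k y - bary M j k x) *\<^sub>R f (tri_pt M j k))"
    using p1D[OF assms(1-3)] p1D[OF assms(1,2,4)]
    by (simp add: scaleR_diff_left sum_subtractf left_diff_distrib)
  also have "\<dots> = tri_grad M f j \<bullet> (y - x)"
    by (simp add: bary_diff tri_grad_def inner_sum_left mult.commute)
  finally show ?thesis .
qed

lemma continuous_on_p1:
  fixes f :: "real^3 \<Rightarrow> 'a::real_normed_vector"
  assumes "p1 M f"
  shows "continuous_on (surf M) f"
  unfolding surf_eq
proof (intro continuous_on_closed_Union)
  fix j assume j: "j \<in> {1..ntri M}"
  have "continuous_on (closed_tri M j) (\<lambda>x. \<Sum>k=1..3. bary M j k x *\<^sub>R f (tri_pt M j k))"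
    by (intro continuous_intros)
  then show "continuous_on (closed_tri M j) f"
    using p1D[OF assms j] by (simp cong: continuous_on_cong)
qed (auto simp: closed_closed_tri)

lemma tri_grad_orthogonal: "tri_grad M f j \<bullet> tri_cross M j = 0"
  by (simp add: tri_grad_def inner_sum_left bary_grad_orthogonal)

lemma outer_prod_mult: "outer_prod a b *v v = (b \<bullet> v) *\<^sub>R a"
  by (simp add: outer_prod_def matrix_vector_mult_def vec_eq_iff inner_vec_def sum_distrib_left
      sum_distrib_right mult_ac)

text \<open>The difference \<open>v - w\<close> is orthogonal to \<open>a\<close> and
  \<open>b\<close>. By the expansion of the double cross product it is a multiple of their normal,
  which the projection removes, while \<open>w\<close> itself is tangential.\<close>

lemma tangential_projection:
  fixes a b v w :: "real^3"
  assumes "cross3 a b \<noteq> 0" "w \<bullet> cross3 a b = 0" "v \<bullet> a = w \<bullet> a" "v \<bullet> b = w \<bullet> b"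
    and n: "n = cross3 a b /\<^sub>R norm (cross3 a b)"
  shows "(mat 1 - outer_prod n n) *v v = w"
proof -
  define c where "c = cross3 a b"
  have "norm c \<noteq> 0"
    using assms(1) by (simp add: c_def)
  have "cross3 (v - w) c = ((v - w) \<bullet> b) *\<^sub>R a - ((v - w) \<bullet> a) *\<^sub>R b"
    unfolding c_def by (simp add: cross3_simps) (simp add: forall_3)
  then have "cross3 (v - w) c = 0"
    using assms(3,4) by (simp add: inner_diff_left)
  moreover have "cross3 c (cross3 (v - w) c) = (c \<bullet> c) *\<^sub>R (v - w) - (c \<bullet> (v - w)) *\<^sub>R c"
    by (simp add: cross3_simps) (simp add: forall_3 algebra_simps)
  ultimately have "(c \<bullet> c) *\<^sub>R (v - w) = (c \<bullet> v) *\<^sub>R c"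
    using assms(2) by (simp add: c_def inner_diff_right inner_commute)
  moreover have "(n \<bullet> v) *\<^sub>R n = ((c \<bullet> v) / (norm c)\<^sup>2) *\<^sub>R c"
    unfolding n c_def[symmetric] using \<open>norm c \<noteq> 0\<close> by (simp add: power2_eq_square field_simps)
  ultimately have "(n \<bullet> v) *\<^sub>R n = v - w"
    using \<open>norm c \<noteq> 0\<close>
    by (metis (no_types, lifting) divide_inverse_commute dot_square_norm left_inverse norm_eq_zero
        power_not_zero scaleR_one scaleR_scaleR)
  then show ?thesis
    by (simp add: matrix_vector_mult_diff_rdistrib outer_prod_mult)
qed

section \<open>Conforming meshes: nodal interpolation, location of points, surface gradients\<close>

locale surface_mesh =
  fixes M :: mesh
  assumes triangulation: "triangulation M"
    and boundary: "boundary_polygon M"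
    and nondegenerate: "j \<in> {1..ntri M} \<Longrightarrow> tri_cross M j \<noteq> 0"
begin

abbreviation tri_verts :: "nat \<Rightarrow> nat set" where
  "tri_verts j \<equiv> tri M j ` {1..3}"

lemma inj_on_vert: "inj_on (vert M) {1..nvert M}"
  and Union_tri_verts: "(\<Union>j\<in>{1..ntri M}. tri_verts j) = {1..nvert M}"
  and open_tri_disjoint: "disjoint_family_on (open_tri M) {1..ntri M}"
  using triangulation by (simp_all add: triangulation_def)

lemma closed_tri_Int:
  "i \<in> {1..ntri M} \<Longrightarrow> j \<in> {1..ntri M} \<Longrightarrow> i \<noteq> j \<Longrightarrow>
    closed_tri M i \<inter> closed_tri M j = convex hull (vert M ` (tri_verts i \<inter> tri_verts j))"
  using triangulation by (simp add: triangulation_def closure_open_tri)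

lemma local_interp_tri_pt:
  assumes "j \<in> {1..ntri M}" "k \<in> {1..3}"
  shows "local_interp M v j (tri_pt M j k) = v (tri M j k)"
  using assms by (simp add: local_interp_def bary_tri_pt[OF nondegenerate] sum_3_delta
      cong: sum.cong del: atLeastAtMost_iff)

text \<open>Both local interpolants are affine on all of space, so they agree on a convex set. It
  contains the common vertices, and by conformity the triangles meet exactly in the convex hull of
  these.\<close>

lemma local_interp_consistent:
  assumes "i \<in> {1..ntri M}" "j \<in> {1..ntri M}" "x \<in> closed_tri M i" "x \<in> closed_tri M j"
  shows "local_interp M v i x = local_interp M v j x"
proof (cases "i = j")
  case False
  let ?S = "{y. local_interp M v i y = local_interp M v j y}"
  have affine: "local_interp M v l ((1 - s) *\<^sub>R y + s *\<^sub>R z) =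
      (1 - s) *\<^sub>R local_interp M v l y + s *\<^sub>R local_interp M v l z" for l y z s
    by (simp add: local_interp_def bary_affine scaleR_add_left scaleR_sum_right sum.distrib)
  have "convex ?S"
    by (auto simp: convex_alt affine)
  moreover have "local_interp M v l (vert M c) = v c" if "l \<in> {1..ntri M}" "c \<in> tri_verts l" for l c
    using that(2) local_interp_tri_pt[OF that(1)] by (fastforce simp: tri_pt_def)
  note this[OF assms(1)] this[OF assms(2)]
  then have "vert M ` (tri_verts i \<inter> tri_verts j) \<subseteq> ?S"
    by (intro image_subsetI CollectI) (metis IntD1 IntD2)
  ultimately have "convex hull (vert M ` (tri_verts i \<inter> tri_verts j)) \<subseteq> ?S"
    by (rule hull_minimal[rotated])
  then show ?thesis
    using closed_tri_Int[OF assms(1,2) False] assms(3,4) by blast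
qed simp

lemma interp_eq:
  assumes "j \<in> {1..ntri M}" "x \<in> closed_tri M j"
  shows "interp M v x = local_interp M v j x"
proof -
  define i where "i = (SOME j. j \<in> {1..ntri M} \<and> x \<in> closed_tri M j)"
  have "i \<in> {1..ntri M} \<and> x \<in> closed_tri M i"
    unfolding i_def by (rule someI) (use assms in blast)
  then have "local_interp M v i x = local_interp M v j x"
    using assms by (intro local_interp_consistent) auto
  moreover have "x \<in> surf M"
    using assms by (auto simp: surf_eq)
  ultimately show ?thesis
    by (simp add: interp_def i_def)
qed

lemma interp_tri_pt:
  "j \<in> {1..ntri M} \<Longrightarrow> k \<in> {1..3} \<Longrightarrow> interp M v (tri_pt M j k) = v (tri M j k)"
  by (simp add: interp_eq[OF _ tri_pt_in_closed_tri] local_interp_tri_pt)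

lemma tri_in_range: "j \<in> {1..ntri M} \<Longrightarrow> k \<in> {1..3} \<Longrightarrow> tri M j k \<in> {1..nvert M}"
  using Union_tri_verts by blast

lemma interp_vert:
  assumes "c \<in> {1..nvert M}"
  shows "interp M v (vert M c) = v c"
proof -
  obtain j k where "j \<in> {1..ntri M}" "k \<in> {1..3}" "c = tri M j k"
    using assms Union_tri_verts by blast
  then show ?thesis
    using interp_tri_pt[of j k v] by (simp add: tri_pt_def)
qed

lemma p1_interp: "p1 M (interp M v)"
  unfolding p1_def
  by (simp add: interp_eq local_interp_def interp_tri_pt del: atLeastAtMost_iff)

lemma p1_eqI:
  assumes "p1 M f" "p1 M g" "f \<in> extensional (surf M)" "g \<in> extensional (surf M)"
    and "\<And>c. c \<in> {1..nvert M} \<Longrightarrow> f (vert M c) = g (vert M c)"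
  shows "f = g"
proof (rule extensionalityI[OF assms(3,4)])
  fix x assume "x \<in> surf M"
  then obtain j where j: "j \<in> {1..ntri M}" "x \<in> closed_tri M j"
    by (auto simp: surf_eq)
  have "f (tri_pt M j k) = g (tri_pt M j k)" if "k \<in> {1..3}" for k
    unfolding tri_pt_def by (intro assms(5) tri_in_range j that)
  then show "f x = g x"
    unfolding p1D[OF assms(1) j] p1D[OF assms(2) j] by simp
qed

text \<open>The hat functions locate a point combinatorially: which of them are positive at a point
  determines the vertex, edge or triangle in whose relative interior it lies.\<close>

abbreviation hat :: "nat \<Rightarrow> real^3 \<Rightarrow> real" where
  "hat c \<equiv> interp M (\<lambda>d. if d = c then 1 else 0)"

lemma hat_eq_0: "j \<in> {1..ntri M} \<Longrightarrow> x \<in> closed_tri M j \<Longrightarrow> c \<notin> tri_verts j \<Longrightarrow> hat c x = 0"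
  by (auto simp: interp_eq local_interp_def intro!: sum.neutral)

lemma hat_pos:
  assumes "j \<in> {1..ntri M}" "x \<in> open_tri M j" "c \<in> tri_verts j"
  shows "hat c x > 0"
proof -
  obtain k where k: "k \<in> {1..3}" "c = tri M j k"
    using assms(3) by blast
  have pos: "bary M j l x > 0" if "l \<in> {1..3}" for l
    using assms(2) that by (simp add: open_tri_bary[OF nondegenerate[OF assms(1)]] del: atLeastAtMost_iff)
  have "hat c x = (\<Sum>l=1..3. bary M j l x *\<^sub>R (if tri M j l = c then 1 else 0))"
    using assms(1) subsetD[OF open_tri_subset assms(2)] by (simp add: interp_eq local_interp_def)
  also have "\<dots> > 0"
    using k pos by (intro sum_pos2[of _ k]) (auto simp: less_imp_le simp del: atLeastAtMost_iff)
  finally show ?thesis .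
qed

lemma vert_in_closed_tri:
  assumes "c \<in> {1..nvert M}" "j \<in> {1..ntri M}"
  shows "vert M c \<in> closed_tri M j \<longleftrightarrow> c \<in> tri_verts j"
proof
  assume "vert M c \<in> closed_tri M j"
  then show "c \<in> tri_verts j"
    using hat_eq_0[of j "vert M c" c] assms interp_vert[OF assms(1), of "\<lambda>d. if d = c then 1 else (0::real)"]
    by auto
next
  assume "c \<in> tri_verts j"
  then show "vert M c \<in> closed_tri M j"
    using tri_pt_in_closed_tri[of _ M j] by (auto simp: tri_pt_def)
qed

lemma inj_on_tri: "j \<in> {1..ntri M} \<Longrightarrow> inj_on (tri M j) {1..3}"
  using inj_on_tri_pt[OF nondegenerate] unfolding inj_on_def tri_pt_def by metis

lemma tri_pt_image: "tri_pt M j ` A = vert M ` (tri M j ` A)"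
  by (auto simp: tri_pt_def)

text \<open>At \<open>x\<close> the hat functions of the three corners of triangle \<open>j\<close>
  are positive, while those of vertices outside triangle \<open>i\<close> vanish. Hence both
  triangles have the same corners and the same relative interior, and disjointness forces equal
  indices.\<close>

lemma open_tri_Int_closed_tri:
  assumes "i \<in> {1..ntri M}" "j \<in> {1..ntri M}" "x \<in> open_tri M j" "x \<in> closed_tri M i"
  shows "i = j"
proof -
  have "tri_verts j \<subseteq> tri_verts i"
    using hat_pos[OF assms(2,3)] hat_eq_0[OF assms(1,4)] by force
  then have "tri_verts j = tri_verts i"
    using inj_on_tri[OF assms(1)] inj_on_tri[OF assms(2)]
    by (intro card_subset_eq) (simp_all add: card_image)
  then have "tri_pt M j ` {1..3} = tri_pt M i ` {1..3}"
    by (metis (no_types) tri_pt_image)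
  then have "open_tri M i = open_tri M j"
    by (simp add: open_tri_def)
  then show ?thesis
    using disjoint_family_onD[OF open_tri_disjoint assms(1,2)] assms(3) by blast
qed

lemma tri_at_eq: "j \<in> {1..ntri M} \<Longrightarrow> x \<in> open_tri M j \<Longrightarrow> tri_at M x = j"
  unfolding tri_at_def using open_tri_Int_closed_tri open_tri_subset by (intro the_equality) blast+

lemma normal_eq: "j \<in> {1..ntri M} \<Longrightarrow> x \<in> open_tri M j \<Longrightarrow> normal M x = tri_normal M j"
  by (simp add: normal_def tri_at_eq)

text \<open>The other triangles form a closed set missing \<open>x\<close>, so near \<open>x\<close>
  the surface is triangle \<open>j\<close> alone and \<open>f\<close> equals an affine function
  there.\<close>

lemma p1_has_derivative:
  assumes "p1 M f" "j \<in> {1..ntri M}" "x \<in> open_tri M j"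
  shows "(f has_derivative (\<lambda>h. tri_grad M f j \<bullet> h)) (at x within surf M)"
proof -
  define C where "C = (\<Union>i\<in>{1..ntri M} - {j}. closed_tri M i)"
  have "closed C"
    unfolding C_def by (intro closed_UN) (auto simp: closed_closed_tri)
  moreover have "x \<notin> C"
    using open_tri_Int_closed_tri[OF _ assms(2,3)] by (auto simp: C_def)
  ultimately obtain e where e: "e > 0" "ball x e \<inter> C = {}"
    using open_contains_ball[of "- C"] by (metis ComplI open_Compl disjoint_eq_subset_Compl)
  have x: "x \<in> closed_tri M j"
    using assms(3) open_tri_subset by blast
  have "((\<lambda>y. f x + tri_grad M f j \<bullet> (y - x)) has_derivative (\<lambda>h. tri_grad M f j \<bullet> h)) (at x within surf M)"
    by (auto intro!: derivative_eq_intros)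
  then show ?thesis
  proof (rule has_derivative_transform_within[OF _ e(1)])
    show "x \<in> surf M"
      using x assms(2) closed_tri_subset_surf by blast
    fix y assume "y \<in> surf M" "dist y x < e"
    then have "y \<in> closed_tri M j"
      using e(2) by (auto simp: surf_eq C_def dist_commute disjoint_iff)
    then show "f x + tri_grad M f j \<bullet> (y - x) = f y"
      using p1_increment[OF assms(1,2) x, of y] by linarith
  qed
qed

text \<open>A derivative within the surface leaves the normal component undetermined, so uniqueness
  of derivatives fails in space. It is applied instead to \<open>f\<close> along the line through
  \<open>x\<close> parallel to an edge, a function of one variable.\<close>

lemma ambient_grad_tangential:
  assumes "p1 M f" "j \<in> {1..ntri M}" "x \<in> open_tri M j" "k \<in> {1..3}" "l \<in> {1..3}"
  shows "ambient_grad M f x \<bullet> (tri_pt M j k - tri_pt M j l) = tri_grad M f j \<bullet> (tri_pt M j k - tri_pt M j l)"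
proof -
  define v where "v = ambient_grad M f x"
  define e where "e = tri_pt M j k - tri_pt M j l"
  have v: "(f has_derivative (\<lambda>h. v \<bullet> h)) (at x within surf M)"
    unfolding v_def ambient_grad_def 
    by (rule someI[where P = "\<lambda>v. (f has_derivative (\<lambda>h. v \<bullet> h)) (at x within surf M)",
          OF p1_has_derivative[OF assms(1-3)]])
  \<comment> \<open>For parameters in the open set \<open>T\<close> the line stays in the triangle,
    so the derivative at 0 within \<open>T\<close> is an ordinary one.\<close>
  define T where "T = {t. \<forall>k\<in>{1..3}. 0 < bary M j k (x + t *\<^sub>R e)}"
  have T: "T = (\<Inter>k\<in>{1..3}. {t. 0 < bary M j k (x + t *\<^sub>R e)})"
    by (auto simp: T_def)
  have "open T"
    unfolding T by (intro open_INT ballI open_Collect_less continuous_intros) auto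
  moreover have "0 \<in> T"
    using assms(3) by (simp add: T_def open_tri_bary[OF nondegenerate[OF assms(2)]])
  ultimately have at_T: "at 0 within T = at 0"
    by (intro at_within_open)
  have sub: "x + t *\<^sub>R e \<in> surf M" if "t \<in> T" for t
  proof -
    have nz: "tri_cross M j \<noteq> 0"
      by (rule nondegenerate[OF assms(2)])
    have x: "x = (\<Sum>m=1..3. bary M j m x *\<^sub>R tri_pt M j m)"
      using assms(3) open_tri_bary[OF nz] by blast
    \<comment> \<open>Moving along the edge by \<open>t\<close> transfers the weight
      \<open>t\<close> from corner \<open>l\<close> to corner \<open>k\<close>.\<close>
    define u where "u m = bary M j m x + t * ((if m = k then 1 else 0) - (if m = l then 1 else 0))" for m
    have eq: "x + t *\<^sub>R e = (\<Sum>m=1..3. u m *\<^sub>R tri_pt M j m)"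
    proof -
      have "(\<Sum>m=1..3. u m *\<^sub>R tri_pt M j m) = (\<Sum>m=1..3. bary M j m x *\<^sub>R tri_pt M j m) +
          t *\<^sub>R ((\<Sum>m=1..3. (if m = k then 1 else 0) *\<^sub>R tri_pt M j m) -
                  (\<Sum>m=1..3. (if m = l then 1 else 0) *\<^sub>R tri_pt M j m))"
        by (simp add: u_def sum_1_3 algebra_simps)
      then show ?thesis
        using x assms(4,5) by (simp only: sum_3_delta e_def)
    qed
    have sum_u: "sum u {1..3} = 1"
      using assms(4,5) sum_bary[of M j x]
      by (simp add: u_def sum.distrib sum_subtractf flip: sum_distrib_left)
    have "bary M j m (x + t *\<^sub>R e) = u m" if "m \<in> {1..3}" for m
      using bary_convex_comb[OF nz that sum_u] eq by simp
    with that have u_nonneg: "\<forall>m\<in>{1..3}. 0 \<le> u m"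
      by (auto simp: T_def simp del: atLeastAtMost_iff intro: less_imp_le)
    have "x + t *\<^sub>R e \<in> closed_tri M j"
      unfolding closed_tri_eq by (intro CollectI exI[of _ u] conjI eq sum_u u_nonneg)
    then show ?thesis
      using closed_tri_subset_surf[OF assms(2)] by blast
  qed
  have "((\<lambda>t. f (x + t *\<^sub>R e)) has_derivative (\<lambda>t. w \<bullet> (t *\<^sub>R e))) (at 0)"
    if w: "(f has_derivative (\<lambda>h. w \<bullet> h)) (at x within surf M)" for w
  proof -
    have "((\<lambda>t. x + t *\<^sub>R e) has_derivative (\<lambda>t. t *\<^sub>R e)) (at 0 within T)"
      by (auto intro!: derivative_eq_intros)
    moreover have "(f has_derivative (\<lambda>h. w \<bullet> h)) (at (x + 0 *\<^sub>R e) within (\<lambda>t. x + t *\<^sub>R e) ` T)"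
      using sub by (auto intro!: has_derivative_subset[OF w])
    ultimately have "((\<lambda>t. f (x + t *\<^sub>R e)) has_derivative (\<lambda>t. w \<bullet> (t *\<^sub>R e))) (at 0 within T)"
      by (rule has_derivative_in_compose)
    then show ?thesis
      unfolding at_T .
  qed
  from has_derivative_unique[OF this[OF v] this[OF p1_has_derivative[OF assms(1-3)]]]
  have "v \<bullet> (1 *\<^sub>R e) = tri_grad M f j \<bullet> (1 *\<^sub>R e)"
    by metis
  then show ?thesis
    by (simp add: v_def e_def)
qed

lemma surf_grad_eq:
  assumes "p1 M f" "j \<in> {1..ntri M}" "x \<in> open_tri M j"
  shows "surf_grad M f x = tri_grad M f j"
  unfolding surf_grad_def normal_eq[OF assms(2,3)] tri_normal_def tri_cross_def
  using ambient_grad_tangential[OF assms, of 2 1] ambient_grad_tangential[OF assms, of 3 1]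
    nondegenerate[OF assms(2)] tri_grad_orthogonal[of M f j]
  by (intro tangential_projection) (simp_all add: tri_cross_def)

end

section \<open>The inner products in terms of nodal values\<close>

text \<open>Both equations contain this expression, with the roles of trial and test function
  exchanged; this is why the lumped terms cancel on the diagonal.\<close>

definition lumped_normal :: "mesh \<Rightarrow> (real^3 \<Rightarrow> real^3) \<Rightarrow> (real^3 \<Rightarrow> real) \<Rightarrow> real" where
  "lumped_normal M X \<psi> = 1/3 * (\<Sum>j=1..ntri M. \<Sum>k=1..3.
     tri_area M j * (X (tri_pt M j k) \<bullet> (\<psi> (tri_pt M j k) *\<^sub>R tri_normal M j)))"

definition dirichlet :: "mesh \<Rightarrow> (real^3 \<Rightarrow> real) \<Rightarrow> (real^3 \<Rightarrow> real) \<Rightarrow> real" where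
  "dirichlet M f g = (\<Sum>j=1..ntri M. tri_area M j * (tri_grad M f j \<bullet> tri_grad M g j))"

text \<open>Six times the integral over the unit interval of the product of two affine functions
  with end values \<open>a\<close>, \<open>a'\<close> and \<open>b\<close>, \<open>b'\<close>: the
  element mass matrix with entries 2 and 1.\<close>

definition seg_mass :: "real \<Rightarrow> real \<Rightarrow> real \<Rightarrow> real \<Rightarrow> real" where
  "seg_mass a a' b b' = 2 * a * b + a * b' + a' * b + 2 * a' * b'"

definition bnormal_mass :: "mesh \<Rightarrow> (real^3 \<Rightarrow> real^3) \<Rightarrow> (real^3 \<Rightarrow> real^3) \<Rightarrow> real" where
  "bnormal_mass M X Y = (\<Sum>j=1..nseg M. norm (seg_pt M j 2 - seg_pt M j 1) / 6 *
     seg_mass (X (seg_pt M j 1) \<bullet> seg_normal M j) (X (seg_pt M j 2) \<bullet> seg_normal M j)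
              (Y (seg_pt M j 1) \<bullet> seg_normal M j) (Y (seg_pt M j 2) \<bullet> seg_normal M j))"

lemma integral_affine_product:
  fixes L :: real
  assumes "L > 0"
  shows "(LINT s:{0<..<L}|lborel. ((1 - s/L) * a + s/L * a') * ((1 - s/L) * b + s/L * b'))
    = L / 6 * seg_mass a a' b b'"
proof -
  define A where "A = (a' - a) / L"
  define B where "B = (b' - b) / L"
  have f: "((1 - s/L) * a + s/L * a') * ((1 - s/L) * b + s/L * b') = (a + A * s) * (b + B * s)" for s
    using assms by (simp add: A_def B_def field_simps)
  define F where "F s = a * b * s + (a * B + A * b) * s\<^sup>2 / 2 + A * B * s ^ 3 / 3" for s :: real
  have "(LBINT s=ereal 0..ereal L. (a + A * s) * (b + B * s)) = F L - F 0"
  proof (rule interval_integral_FTC_finite)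
    show "continuous_on {min 0 L..max 0 L} (\<lambda>s. (a + A * s) * (b + B * s))"
      by (intro continuous_intros)
    show "(F has_vector_derivative (a + A * x) * (b + B * x)) (at x within {min 0 L..max 0 L})" for x
      unfolding F_def has_real_derivative_iff_has_vector_derivative[symmetric]
      by (auto intro!: derivative_eq_intros simp: field_simps power2_eq_square)
  qed
  also have "F L - F 0 = L / 6 * seg_mass a a' b b'"
    using assms by (simp add: F_def A_def B_def seg_mass_def power2_eq_square power3_eq_cube field_simps)
  finally show ?thesis
    unfolding f using assms by (simp add: interval_lebesgue_integral_def)
qed

lemma seg_param:
  assumes "seg_pt M j 1 \<noteq> seg_pt M j 2"
  shows "seg_pt M j 1 + s *\<^sub>R seg_dir M j =
    (1 - s / norm (seg_pt M j 2 - seg_pt M j 1)) *\<^sub>R seg_pt M j 1 +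
    (s / norm (seg_pt M j 2 - seg_pt M j 1)) *\<^sub>R seg_pt M j 2"
  by (simp add: seg_dir_def algebra_simps divide_inverse)

context surface_mesh
begin

text \<open>\<open>Lim\<close> has a determined value only along a nontrivial filter: the corner
  lies in the closure of the open triangle but not in the open triangle itself, because another
  barycentric coordinate vanishes there.\<close>

lemma Lim_open_tri:
  assumes "j \<in> {1..ntri M}" "k \<in> {1..3}" "continuous_on (closed_tri M j) g"
    and "\<And>x. x \<in> open_tri M j \<Longrightarrow> f x = (g x :: 'a::t2_space)"
  shows "Lim (at (tri_pt M j k) within open_tri M j) f = g (tri_pt M j k)"
proof (rule tendsto_Lim)
  have "tri_pt M j k \<in> closure (open_tri M j)"
    using assms(2) by (simp add: closure_open_tri tri_pt_in_closed_tri del: atLeastAtMost_iff)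
  moreover have "tri_pt M j k \<notin> open_tri M j"
  proof
    assume *: "tri_pt M j k \<in> open_tri M j"
    define l :: nat where "l = (if k = 1 then 2 else 1)"
    have l: "l \<in> {1..3}" "l \<noteq> k"
      by (auto simp: l_def)
    have "0 < bary M j l (tri_pt M j k)"
      using * l(1) open_tri_bary[OF nondegenerate[OF assms(1)]] by blast
    then show False
      using bary_tri_pt[OF nondegenerate[OF assms(1)] l(1) assms(2)] l(2) by simp
  qed
  ultimately show "at (tri_pt M j k) within open_tri M j \<noteq> bot"
    by (simp add: trivial_limit_within closure_def)
  have "(g \<longlongrightarrow> g (tri_pt M j k)) (at (tri_pt M j k) within open_tri M j)"
    using assms(3) tri_pt_in_closed_tri[OF assms(2)] unfolding continuous_on_def
    by (intro tendsto_within_subset[OF _ open_tri_subset]) blast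
  then show "(f \<longlongrightarrow> g (tri_pt M j k)) (at (tri_pt M j k) within open_tri M j)"
    by (rule Lim_transform_eventually) (simp add: eventually_at_filter assms(4))
qed

lemma continuous_on_closed_tri_p1:
  fixes f :: "real^3 \<Rightarrow> 'a::real_normed_vector"
  shows "p1 M f \<Longrightarrow> j \<in> {1..ntri M} \<Longrightarrow> continuous_on (closed_tri M j) f"
  by (rule continuous_on_subset[OF continuous_on_p1 closed_tri_subset_surf])

lemma Lim_p1:
  fixes f :: "real^3 \<Rightarrow> 'a::real_normed_vector"
  assumes "p1 M f" "j \<in> {1..ntri M}" "k \<in> {1..3}"
  shows "Lim (at (tri_pt M j k) within open_tri M j) f = f (tri_pt M j k)"
  using assms by (intro Lim_open_tri continuous_on_closed_tri_p1 refl)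

lemma Lim_p1_normal:
  assumes "p1 M \<psi>" "j \<in> {1..ntri M}" "k \<in> {1..3}"
  shows "Lim (at (tri_pt M j k) within open_tri M j) (\<lambda>x. \<psi> x *\<^sub>R normal M x) =
    \<psi> (tri_pt M j k) *\<^sub>R tri_normal M j"
  using assms by (intro Lim_open_tri continuous_intros continuous_on_closed_tri_p1) (simp_all add: normal_eq)

lemma lumped_prod_normal_right:
  "p1 M X \<Longrightarrow> p1 M \<psi> \<Longrightarrow> lumped_prod M X (\<lambda>x. \<psi> x *\<^sub>R normal M x) = lumped_normal M X \<psi>"
  unfolding lumped_prod_def lumped_normal_def
  by (simp add: Lim_p1 Lim_p1_normal del: atLeastAtMost_iff)

lemma lumped_prod_normal_left:
  "p1 M X \<Longrightarrow> p1 M \<psi> \<Longrightarrow> lumped_prod M (\<lambda>x. \<psi> x *\<^sub>R normal M x) X = lumped_normal M X \<psi>"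
  unfolding lumped_prod_def lumped_normal_def
  by (simp add: Lim_p1 Lim_p1_normal inner_commute del: atLeastAtMost_iff)

lemma surf_prod_surf_grad:
  assumes "p1 M f" "p1 M g"
  shows "surf_prod M (surf_grad M f) (surf_grad M g) = dirichlet M f g"
  unfolding surf_prod_def dirichlet_def using assms
  by (intro sum.cong refl tri_integral_const nondegenerate) (simp_all add: surf_grad_eq)

lemma surf_prod_surf_grad_vec:
  assumes "p1 M X" "p1 M Y"
  shows "surf_prod M (surf_grad_vec M X) (surf_grad_vec M Y) =
    (\<Sum>i\<in>UNIV. dirichlet M (\<lambda>x. X x $ i) (\<lambda>x. Y x $ i))"
proof -
  have "p1 M (\<lambda>x. X x $ i)" "p1 M (\<lambda>x. Y x $ i)" for i
    using assms p1_component by blast+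
  then have "tri_integral M j (\<lambda>x. surf_grad_vec M X x \<bullet> surf_grad_vec M Y x) =
      tri_area M j * (\<Sum>i\<in>UNIV. tri_grad M (\<lambda>x. X x $ i) j \<bullet> tri_grad M (\<lambda>x. Y x $ i) j)"
    if "j \<in> {1..ntri M}" for j
    using that by (intro tri_integral_const nondegenerate)
      (simp_all add: surf_grad_vec_def inner_vec_def surf_grad_eq)
  then have "surf_prod M (surf_grad_vec M X) (surf_grad_vec M Y) =
      (\<Sum>j=1..ntri M. \<Sum>i\<in>UNIV. tri_area M j * (tri_grad M (\<lambda>x. X x $ i) j \<bullet> tri_grad M (\<lambda>x. Y x $ i) j))"
    by (simp add: surf_prod_def sum_distrib_left del: atLeastAtMost_iff)
  then show ?thesis
    unfolding dirichlet_def by (subst sum.swap)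
qed

section \<open>Boundary segments and integrals over the boundary curve\<close>

lemma seg_in_tri:
  assumes "j \<in> {1..nseg M}"
  obtains i a b where "i \<in> {1..ntri M}" "a \<in> {1..3}" "b \<in> {1..3}" "a \<noteq> b"
    "seg M j 1 = tri M i a" "seg M j 2 = tri M i b"
proof -
  have "{seg M j 1, seg M j 2} \<in> boundary_edges M"
    using boundary assms unfolding boundary_polygon_def bij_betw_def by blast
  then obtain i where i: "i \<in> {1..ntri M}" "{seg M j 1, seg M j 2} \<in> edges M i"
    unfolding boundary_edges_def by blast
  then have "{seg M j 1, seg M j 2} \<in> {{tri M i 1, tri M i 2}, {tri M i 2, tri M i 3}, {tri M i 3, tri M i 1}}"
    by (simp add: edges_def dir_edges_def)
  then have "\<exists>a\<in>{1, 2, 3}. \<exists>b\<in>{1, 2, 3}. a \<noteq> b \<and> {seg M j 1, seg M j 2} = {tri M i a, tri M i b}"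
    by (simp, elim disjE) simp_all
  then obtain a b where "a \<in> {1..3}" "b \<in> {1..3}" "a \<noteq> b" "{seg M j 1, seg M j 2} = {tri M i a, tri M i b}"
    unfolding one_to_three by blast
  \<comment> \<open>Boundary edges are unordered pairs, so the segment may run along the edge in
    either direction; exchanging \<open>a\<close> and \<open>b\<close> covers both cases.\<close>
  then show thesis
    using that[OF i(1), of a b] that[OF i(1), of b a] unfolding doubleton_eq_iff by metis
qed

lemma seg_pt_in_tri:
  assumes "j \<in> {1..nseg M}"
  obtains i where "i \<in> {1..ntri M}" "seg_pt M j 1 \<in> closed_tri M i" "seg_pt M j 2 \<in> closed_tri M i"
  using seg_in_tri[OF assms] tri_pt_in_closed_tri unfolding tri_pt_def seg_pt_def by metis

lemma seg_in_range:
  assumes "j \<in> {1..nseg M}"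
  shows "seg M j 1 \<in> {1..nvert M}" "seg M j 2 \<in> {1..nvert M}"
  using seg_in_tri[OF assms] tri_in_range by metis+

lemma seg_pt_neq: "j \<in> {1..nseg M} \<Longrightarrow> seg_pt M j 1 \<noteq> seg_pt M j 2"
  using seg_in_tri[of j] inj_on_tri_pt[OF nondegenerate]
  unfolding tri_pt_def seg_pt_def inj_on_def by metis

lemma p1_on_segment:
  assumes "p1 M f" "j \<in> {1..nseg M}" "0 \<le> s" "s \<le> 1"
  shows "f ((1 - s) *\<^sub>R seg_pt M j 1 + s *\<^sub>R seg_pt M j 2) =
    (1 - s) *\<^sub>R f (seg_pt M j 1) + s *\<^sub>R f (seg_pt M j 2)"
proof -
  obtain i where i: "i \<in> {1..ntri M}" "seg_pt M j 1 \<in> closed_tri M i" "seg_pt M j 2 \<in> closed_tri M i"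
    using seg_pt_in_tri[OF assms(2)] .
  have "(1 - s) *\<^sub>R seg_pt M j 1 + s *\<^sub>R seg_pt M j 2 \<in> closed_tri M i"
    using i(2,3) assms(3,4) unfolding closed_tri_def by (intro convexD_alt convex_convex_hull)
  from p1D[OF assms(1) i(1) this] show ?thesis
    unfolding bary_affine p1D[OF assms(1) i(1,2)] p1D[OF assms(1) i(1,3)]
    by (simp add: scaleR_add_left scaleR_sum_right sum.distrib)
qed

lemma bcurve_subset_surf: "bcurve M \<subseteq> surf M"
proof
  fix x assume "x \<in> bcurve M"
  then obtain j where j: "j \<in> {1..nseg M}" "x \<in> closed_segment (seg_pt M j 1) (seg_pt M j 2)"
    by (auto simp: bcurve_def)
  then obtain i where i: "i \<in> {1..ntri M}" "seg_pt M j 1 \<in> closed_tri M i" "seg_pt M j 2 \<in> closed_tri M i"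
    using seg_pt_in_tri by blast
  then have "x \<in> closed_tri M i"
    using j(2) closed_segment_subset[of _ "closed_tri M i"] convex_convex_hull
    unfolding closed_tri_def by blast
  then show "x \<in> surf M"
    using i(1) closed_tri_subset_surf by blast
qed

lemma seg_pt_in_bcurve:
  "j \<in> {1..nseg M} \<Longrightarrow> seg_pt M j 1 \<in> bcurve M" "j \<in> {1..nseg M} \<Longrightarrow> seg_pt M j 2 \<in> bcurve M"
  unfolding bcurve_def by blast+

lemma p1_zero_on_bcurve:
  assumes "p1 M f" "\<And>c. c \<in> {1..nvert M} \<Longrightarrow> vert M c \<in> bcurve M \<Longrightarrow> f (vert M c) = 0" "x \<in> bcurve M"
  shows "f x = 0"
proof -
  obtain j where j: "j \<in> {1..nseg M}" "x \<in> closed_segment (seg_pt M j 1) (seg_pt M j 2)"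
    using assms(3) by (auto simp: bcurve_def)
  have "f (seg_pt M j 1) = 0" "f (seg_pt M j 2) = 0"
    using assms(2) seg_in_range[OF j(1)] seg_pt_in_bcurve[OF j(1)] unfolding seg_pt_def by metis+
  then show ?thesis
    using j(2) p1_on_segment[OF assms(1) j(1)] by (auto simp: in_segment)
qed

text \<open>On an open segment exactly the hat functions of its two end points are positive. The
  point thus determines the unordered pair of end points, and the segments enumerate boundary edges
  injectively.\<close>

lemma seg_at_eq:
  assumes "j \<in> {1..nseg M}" "x \<in> open_seg M j"
  shows "seg_at M x = j"
proof -
  have *: "{seg M i 1, seg M i 2} = {c. hat c x > 0}" if i: "i \<in> {1..nseg M}" "x \<in> open_seg M i" for i
  proof -
    obtain s where s: "0 < s" "s < 1" "x = (1 - s) *\<^sub>R seg_pt M i 1 + s *\<^sub>R seg_pt M i 2"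
      using i(2) unfolding open_seg_def in_segment by blast
    have "hat c x = (1 - s) * (if seg M i 1 = c then 1 else 0) + s * (if seg M i 2 = c then 1 else 0)" for c
      using p1_on_segment[OF p1_interp[of "\<lambda>d. if d = c then 1 else (0::real)"] i(1), of s] s(1,2)
      unfolding s(3)[symmetric] unfolding seg_pt_def interp_vert[OF seg_in_range(1)[OF i(1)]]
        interp_vert[OF seg_in_range(2)[OF i(1)]] by simp
    then show ?thesis
      using s(1,2) by auto
  qed
  have "inj_on (\<lambda>j. {seg M j 1, seg M j 2}) {1..nseg M}"
    using boundary by (simp add: boundary_polygon_def bij_betw_def)
  note inj = inj_onD[OF this]
  show ?thesis
    unfolding seg_at_def
  proof (rule the_equality)
    fix i assume i: "i \<in> {1..nseg M} \<and> x \<in> open_seg M i"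
    then have "{seg M i 1, seg M i 2} = {seg M j 1, seg M j 2}"
      unfolding *[OF assms] by (intro *) auto
    then show "i = j"
      using i assms(1) by (intro inj) auto
  qed (use assms in blast)
qed

lemma bcurve_prod_bnormal:
  assumes "p1 M X" "p1 M Y"
  shows "bcurve_prod M (\<lambda>x. X x \<bullet> bnormal M x) (\<lambda>x. Y x \<bullet> bnormal M x) = bnormal_mass M X Y"
  unfolding bcurve_prod_def bnormal_mass_def
proof (intro sum.cong refl)
  fix j assume j: "j \<in> {1..nseg M}"
  define p where "p = seg_pt M j 1"
  define q where "q = seg_pt M j 2"
  define L where "L = norm (q - p)"
  define n where "n = seg_normal M j"
  have L: "L > 0"
    using seg_pt_neq[OF j] by (simp add: L_def p_def q_def)
  have f: "f (p + s *\<^sub>R seg_dir M j) \<bullet> bnormal M (p + s *\<^sub>R seg_dir M j) =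
      (1 - s / L) * (f p \<bullet> n) + s / L * (f q \<bullet> n)" if s: "s \<in> {0<..<L}" and f: "p1 M f" for s f
  proof -
    have u: "0 < s / L" "s / L < 1"
      using s L by auto
    have eq: "p + s *\<^sub>R seg_dir M j = (1 - s / L) *\<^sub>R p + (s / L) *\<^sub>R q"
      using seg_param[OF seg_pt_neq[OF j], of s] by (simp only: p_def q_def L_def)
    then have "p + s *\<^sub>R seg_dir M j \<in> open_seg M j"
      using u seg_pt_neq[OF j] unfolding open_seg_def in_segment p_def q_def by blast
    then have "bnormal M (p + s *\<^sub>R seg_dir M j) = n"
      by (simp add: bnormal_def seg_at_eq[OF j] n_def)
    moreover have "f ((1 - s / L) *\<^sub>R p + (s / L) *\<^sub>R q) = (1 - s / L) *\<^sub>R f p + (s / L) *\<^sub>R f q"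
      unfolding p_def q_def using u by (intro p1_on_segment[OF f j]) auto
    ultimately show ?thesis
      by (simp add: eq inner_add_left)
  qed
  have "seg_integral M j (\<lambda>x. (X x \<bullet> bnormal M x) \<bullet> (Y x \<bullet> bnormal M x)) =
      (LINT s:{0<..<L}|lborel. ((1 - s / L) * (X p \<bullet> n) + s / L * (X q \<bullet> n)) *
        ((1 - s / L) * (Y p \<bullet> n) + s / L * (Y q \<bullet> n)))"
    unfolding seg_integral_def p_def[symmetric] q_def[symmetric] L_def[symmetric]
    by (intro set_lebesgue_integral_cong) (auto simp: f assms simp del: greaterThanLessThan_iff)
  also have "\<dots> = L / 6 * seg_mass (X p \<bullet> n) (X q \<bullet> n) (Y p \<bullet> n) (Y q \<bullet> n)"
    by (rule integral_affine_product[OF L])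
  finally show "seg_integral M j (\<lambda>x. (X x \<bullet> bnormal M x) \<bullet> (Y x \<bullet> bnormal M x)) =
      norm (seg_pt M j 2 - seg_pt M j 1) / 6 *
      seg_mass (X (seg_pt M j 1) \<bullet> seg_normal M j) (X (seg_pt M j 2) \<bullet> seg_normal M j)
        (Y (seg_pt M j 1) \<bullet> seg_normal M j) (Y (seg_pt M j 2) \<bullet> seg_normal M j)"
    by (simp only: p_def q_def L_def n_def)
qed

text \<open>Serves to replace traces by the functions themselves: \<open>btrace\<close> is
  unspecified off the curve, but the integrals see only points of the curve.\<close>

lemma bcurve_prod_cong:
  assumes "\<And>x. x \<in> bcurve M \<Longrightarrow> f x = f' x" "\<And>x. x \<in> bcurve M \<Longrightarrow> g x = g' x"
  shows "bcurve_prod M f g = bcurve_prod M f' g'"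
  unfolding bcurve_prod_def seg_integral_def
proof (intro sum.cong refl set_lebesgue_integral_cong ballI allI impI)
  fix j s assume j: "j \<in> {1..nseg M}" and s: "s \<in> {0<..<norm (seg_pt M j 2 - seg_pt M j 1)}"
  have "seg_pt M j 1 + s *\<^sub>R seg_dir M j \<in> closed_segment (seg_pt M j 1) (seg_pt M j 2)"
    unfolding seg_param[OF seg_pt_neq[OF j]] in_segment
    using s by (intro exI[of _ "s / norm (seg_pt M j 2 - seg_pt M j 1)"]) (auto simp: divide_le_eq)
  then have "seg_pt M j 1 + s *\<^sub>R seg_dir M j \<in> bcurve M"
    using j by (auto simp: bcurve_def)
  then show "f (seg_pt M j 1 + s *\<^sub>R seg_dir M j) \<bullet> g (seg_pt M j 1 + s *\<^sub>R seg_dir M j) =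
     f' (seg_pt M j 1 + s *\<^sub>R seg_dir M j) \<bullet> g' (seg_pt M j 1 + s *\<^sub>R seg_dir M j)"
    by (simp add: assms)
qed simp

section \<open>The finite element spaces described by interpolation\<close>

lemma fe_space_iff: "f \<in> fe_space M \<longleftrightarrow> f \<in> extensional (surf M) \<and> p1 M f"
proof
  assume f: "f \<in> fe_space M"
  have "f x = (\<Sum>k=1..3. bary M j k x *\<^sub>R f (tri_pt M j k))"
    if j: "j \<in> {1..ntri M}" and x: "x \<in> closed_tri M j" for j x
  proof -
    obtain a b where ab: "\<forall>x\<in>open_tri M j. f x = a \<bullet> x + b"
      using f j unfolding fe_space_def by blast
    have "continuous_on (surf M) f"
      using f by (simp add: fe_space_def)
    then have cont: "continuous_on (closed_tri M j) (\<lambda>x. f x - (a \<bullet> x + b))"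
      by (intro continuous_intros) (rule continuous_on_subset[OF _ closed_tri_subset_surf[OF j]])
    \<comment> \<open>Affinity is given on the open triangle only; continuity carries it to the
      closure, in particular to the corners.\<close>
    have eq: "f y = a \<bullet> y + b" if "y \<in> closed_tri M j" for y
      using continuous_constant_on_closure[of "open_tri M j" "\<lambda>x. f x - (a \<bullet> x + b)" 0 y]
        cont ab that by (simp add: closure_open_tri)
    have "x = (\<Sum>k=1..3. bary M j k x *\<^sub>R tri_pt M j k)"
      using x closed_tri_bary[OF nondegenerate[OF j]] by blast
    then have "a \<bullet> x + b = a \<bullet> (\<Sum>k=1..3. bary M j k x *\<^sub>R tri_pt M j k) + (\<Sum>k=1..3. bary M j k x) * b"
      unfolding sum_bary by simp
    also have "\<dots> = (\<Sum>k=1..3. bary M j k x *\<^sub>R (a \<bullet> tri_pt M j k + b))"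
      by (simp add: sum_1_3 inner_add_right algebra_simps)
    also have "\<dots> = (\<Sum>k=1..3. bary M j k x *\<^sub>R f (tri_pt M j k))"
      using eq[OF tri_pt_in_closed_tri] by (simp del: atLeastAtMost_iff)
    finally show ?thesis
      using eq[OF x] by simp
  qed
  with f show "f \<in> extensional (surf M) \<and> p1 M f"
    unfolding p1_def fe_space_def by blast
next
  assume f: "f \<in> extensional (surf M) \<and> p1 M f"
  have "\<exists>a b. \<forall>x\<in>open_tri M j. f x = a \<bullet> x + b" if j: "j \<in> {1..ntri M}" for j
  proof (intro exI ballI)
    fix x assume "x \<in> open_tri M j"
    then show "f x = tri_grad M f j \<bullet> x + (f (tri_pt M j 1) - tri_grad M f j \<bullet> tri_pt M j 1)"
      using p1_increment[of M f j "tri_pt M j 1" x] f j subsetD[OF open_tri_subset, of x M j]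
        tri_pt_in_closed_tri[of 1 M j] by (simp add: inner_diff_right)
  qed
  with f show "f \<in> fe_space M"
    by (auto simp: fe_space_def continuous_on_p1 simp del: atLeastAtMost_iff)
qed

lemma fe_vec_space_iff:
  "X \<in> fe_vec_space M \<longleftrightarrow> X \<in> extensional (surf M) \<and> p1 M X \<and> (\<forall>x\<in>bcurve M. X x $ 3 = 0)"
proof -
  have "(\<lambda>x\<in>surf M. X x $ i) \<in> fe_space M \<longleftrightarrow> p1 M (\<lambda>x. X x $ i)" for i
    unfolding fe_space_iff by (subst p1_cong[of M _ "\<lambda>x. X x $ i"]) auto
  then show ?thesis
    using bcurve_subset_surf unfolding fe_vec_space_def fe_space0_def p1_component forall_3 by auto
qed

lemma p1_surf_id: "p1 M (surf_id M)"
proof -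
  have "p1 M (\<lambda>x. x)"
    unfolding p1_def using closed_tri_bary[OF nondegenerate] by blast
  then show ?thesis
    by (subst p1_cong[of M _ "\<lambda>x. x"]) (auto simp: surf_id_def)
qed

end

section \<open>Nondegenerate bilinear forms on finitely many coordinates\<close>

text \<open>Gaussian elimination by induction on the equations: a zero equation is dropped, any
  other one removes itself together with one unknown, so there remain fewer equations than
  unknowns.\<close>

lemma underdetermined_system:
  fixes B :: "'i \<Rightarrow> 'j \<Rightarrow> real"
  assumes "finite I" "finite J" "card I < card J"
  shows "\<exists>x. (\<exists>j\<in>J. x j \<noteq> 0) \<and> (\<forall>i\<in>I. (\<Sum>j\<in>J. x j * B i j) = 0)"
  using assms
proof (induction I arbitrary: J B rule: finite_induct)
  case empty
  then have "J \<noteq> {}"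
    by auto
  then show ?case
    by (intro exI[of _ "\<lambda>_. 1"]) auto
next
  case (insert i I)
  show ?case
  proof (cases "\<forall>j\<in>J. B i j = 0")
    case True
    obtain x where "\<exists>j\<in>J. x j \<noteq> 0" "\<forall>i\<in>I. (\<Sum>j\<in>J. x j * B i j) = 0"
      using insert.IH[of J B] insert.prems insert.hyps by auto
    with True show ?thesis
      by auto
  next
    case False
    then obtain j\<^sub>0 where j\<^sub>0: "j\<^sub>0 \<in> J" "B i j\<^sub>0 \<noteq> 0"
      by blast
    \<comment> \<open>Subtracting a multiple of equation \<open>i\<close> eliminates the pivot
      unknown \<open>j\<^sub>0\<close> from equation \<open>l\<close>.\<close>
    define B' where "B' l j = B l j - B l j\<^sub>0 * B i j / B i j\<^sub>0" for l j
    have "card I < card (J - {j\<^sub>0})"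
      using insert.prems insert.hyps j\<^sub>0 by (simp add: card_Diff_singleton)
    then obtain x where x: "\<exists>j\<in>J - {j\<^sub>0}. x j \<noteq> 0" "\<forall>l\<in>I. (\<Sum>j\<in>J - {j\<^sub>0}. x j * B' l j) = 0"
      using insert.IH[of "J - {j\<^sub>0}" B'] insert.prems by auto
    define s where "s = (\<Sum>j\<in>J - {j\<^sub>0}. x j * B i j)"
    \<comment> \<open>The pivot unknown is chosen so that equation \<open>i\<close> holds; by the
      construction of \<open>B'\<close> the other equations then hold as well.\<close>
    define y where "y = x(j\<^sub>0 := - s / B i j\<^sub>0)"
    have sum_y: "(\<Sum>j\<in>J. y j * B l j) = (\<Sum>j\<in>J - {j\<^sub>0}. x j * B l j) - s / B i j\<^sub>0 * B l j\<^sub>0" for l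
      using j\<^sub>0 insert.prems by (simp add: sum.remove[of J j\<^sub>0] y_def)
    have "(\<Sum>j\<in>J. y j * B l j) = 0" if "l \<in> I" for l
    proof -
      have "0 = (\<Sum>j\<in>J - {j\<^sub>0}. x j * B' l j)"
        using x(2) that by simp
      also have "\<dots> = (\<Sum>j\<in>J - {j\<^sub>0}. x j * B l j) - s / B i j\<^sub>0 * B l j\<^sub>0"
        by (simp add: B'_def s_def right_diff_distrib sum_subtractf sum_distrib_left sum_distrib_right
            sum_divide_distrib mult_ac)
      finally show ?thesis
        by (simp add: sum_y)
    qed
    moreover have "(\<Sum>j\<in>J. y j * B i j) = 0"
      using j\<^sub>0 by (simp add: sum_y s_def)
    moreover have "\<exists>j\<in>J. y j \<noteq> 0"
      using x(1) by (auto simp: y_def)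
    ultimately show ?thesis
      by (intro exI[of _ y]) simp
  qed
qed

section \<open>Linear dependence on coordinates and solvability\<close>

definition linear_fun :: "(('d \<Rightarrow> real) \<Rightarrow> 'a::real_vector) \<Rightarrow> bool" where
  "linear_fun F \<longleftrightarrow> (\<forall>u v. F (\<lambda>d. u d + v d) = F u + F v) \<and> (\<forall>c u. F (\<lambda>d. c * u d) = c *\<^sub>R F u)"

lemma linear_fun_eval: "linear_fun (\<lambda>u. u d)"
  by (simp add: linear_fun_def)

lemma linear_fun_zero: "linear_fun F \<Longrightarrow> F (\<lambda>_. 0) = 0"
proof -
  assume "linear_fun F"
  then have "\<forall>c u. F (\<lambda>d. c * u d) = c *\<^sub>R F u"
    by (simp add: linear_fun_def)
  from this[rule_format, of 0 "\<lambda>_. 0"] show ?thesis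
    by simp
qed

lemma linear_fun_linear: "linear T \<Longrightarrow> linear_fun F \<Longrightarrow> linear_fun (\<lambda>u. T (F u))"
  by (simp add: linear_fun_def linear_add linear_cmul)

lemma linear_fun_sum: "(\<And>i. i \<in> A \<Longrightarrow> linear_fun (F i)) \<Longrightarrow> linear_fun (\<lambda>u. \<Sum>i\<in>A. F i u)"
  by (simp add: linear_fun_def sum.distrib scaleR_sum_right)

lemma linear_fun_add: "linear_fun F \<Longrightarrow> linear_fun G \<Longrightarrow> linear_fun (\<lambda>u. F u + G u)"
  by (simp add: linear_fun_def scaleR_add_right)

lemma linear_fun_diff: "linear_fun F \<Longrightarrow> linear_fun G \<Longrightarrow> linear_fun (\<lambda>u. F u - G u)"
  by (simp add: linear_fun_def scaleR_diff_right)

lemma linear_fun_scaleR_right: "linear_fun F \<Longrightarrow> linear_fun (\<lambda>u. c *\<^sub>R F u)"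
  by (rule linear_fun_linear[OF linear_scaleR])

lemma linear_fun_scaleR_left: "linear_fun F \<Longrightarrow> linear_fun (\<lambda>u. F u *\<^sub>R a)"
  by (simp add: linear_fun_def scaleR_add_left)

lemma linear_fun_mult_right: "linear_fun F \<Longrightarrow> linear_fun (\<lambda>u. c * F u :: real)"
  and linear_fun_mult_left: "linear_fun F \<Longrightarrow> linear_fun (\<lambda>u. F u * c :: real)"
  by (simp_all add: linear_fun_def algebra_simps)

lemma linear_fun_inner_left: "linear_fun F \<Longrightarrow> linear_fun (\<lambda>u. F u \<bullet> a)"
  and linear_fun_inner_right: "linear_fun F \<Longrightarrow> linear_fun (\<lambda>u. a \<bullet> F u)"
  by (simp_all add: linear_fun_def inner_add_left inner_add_right)

lemma linear_fun_vec_nth: "linear_fun F \<Longrightarrow> linear_fun (\<lambda>u. F u $ i)"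
  by (simp add: linear_fun_def)

lemma linear_fun_vec_lambda:
  "(\<And>i. linear_fun (\<lambda>u. F u i)) \<Longrightarrow> linear_fun (\<lambda>u. \<chi> i. F u i)"
  by (simp add: linear_fun_def vec_eq_iff)

lemmas linear_fun_intros = linear_fun_eval linear_fun_sum linear_fun_add linear_fun_diff
  linear_fun_scaleR_right linear_fun_scaleR_left linear_fun_mult_right linear_fun_mult_left
  linear_fun_inner_left linear_fun_inner_right linear_fun_vec_nth linear_fun_vec_lambda

text \<open>Coordinates outside \<open>J\<close> are fixed as 0, so that uniqueness of a solution
  becomes equality of functions.\<close>

definition supported :: "'d set \<Rightarrow> ('d \<Rightarrow> real) set" where
  "supported J = {u. \<forall>d. d \<notin> J \<longrightarrow> u d = 0}"

definition unit_fun :: "'d \<Rightarrow> 'd \<Rightarrow> real" where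
  "unit_fun d e = (if e = d then 1 else 0)"

lemma linear_fun_expand:
  fixes F :: "('d \<Rightarrow> real) \<Rightarrow> real"
  assumes "finite J" "u \<in> supported J" "linear_fun F"
  shows "F u = (\<Sum>d\<in>J. u d * F (unit_fun d))"
proof -
  have zero: "F (\<lambda>_. 0) = 0"
    by (rule linear_fun_zero[OF assms(3)])
  have "F (\<lambda>e. \<Sum>d\<in>J. u d * unit_fun d e) = (\<Sum>d\<in>J. u d * F (unit_fun d))"
    using assms(1)
  proof (induction J rule: finite_induct)
    case (insert x J)
    have "F (\<lambda>e. u x * unit_fun x e + (\<Sum>d\<in>J. u d * unit_fun d e)) =
        F (\<lambda>e. u x * unit_fun x e) + F (\<lambda>e. \<Sum>d\<in>J. u d * unit_fun d e)"
      using assms(3) unfolding linear_fun_def by simp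
    also have "F (\<lambda>e. u x * unit_fun x e) = u x * F (unit_fun x)"
      using assms(3) unfolding linear_fun_def by simp
    finally show ?case
      using insert by simp
  qed (simp add: zero)
  moreover have "(\<lambda>e. \<Sum>d\<in>J. u d * unit_fun d e) = u"
  proof
    fix e
    have "(\<Sum>d\<in>J. u d * unit_fun d e) = (\<Sum>d\<in>J. if e = d then u d else 0)"
      by (intro sum.cong) (auto simp: unit_fun_def)
    then show "(\<Sum>d\<in>J. u d * unit_fun d e) = u e"
      using assms(1,2) by (simp add: supported_def)
  qed
  ultimately show ?thesis
    by simp
qed

text \<open>The right-hand side becomes the column of an extra unknown \<open>None\<close>. With one
  unknown more than equations there is a nontrivial solution of the homogeneous system, and dividing
  by its extra component solves the original problem.\<close>

lemma nondegenerate_form_solvable: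
  fixes a :: "('d \<Rightarrow> real) \<Rightarrow> ('d \<Rightarrow> real) \<Rightarrow> real"
  assumes fin: "finite J"
    and lin: "\<And>w. linear_fun (\<lambda>u. a u w)" "\<And>u. linear_fun (a u)" "linear_fun F"
    and nondeg: "\<And>u. u \<in> supported J \<Longrightarrow> (\<And>w. w \<in> supported J \<Longrightarrow> a u w = 0) \<Longrightarrow> u = (\<lambda>_. 0)"
  shows "\<exists>!u. u \<in> supported J \<and> (\<forall>w\<in>supported J. a u w = F w)"
proof (rule ex_ex1I)
  define B where "B e d = (case d of None \<Rightarrow> - F (unit_fun e) | Some d' \<Rightarrow> a (unit_fun d') (unit_fun e))" for e d
  have "card J < card (insert None (Some ` J))"
    using fin by (simp add: card_image)
  from underdetermined_system[OF fin _ this, of B] fin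
  obtain x where x: "\<exists>d\<in>insert None (Some ` J). x d \<noteq> 0"
      "\<forall>e\<in>J. (\<Sum>d\<in>insert None (Some ` J). x d * B e d) = 0"
    by auto
  define u where "u d = (if d \<in> J then x (Some d) else 0)" for d
  have u: "u \<in> supported J"
    by (simp add: supported_def u_def)
  have unit: "unit_fun e \<in> supported J" if "e \<in> J" for e
    using that by (auto simp: supported_def unit_fun_def)
  have "a u (unit_fun e) = x None * F (unit_fun e)" if e: "e \<in> J" for e
  proof -
    have "(\<Sum>d\<in>insert None (Some ` J). x d * B e d) =
        (\<Sum>d\<in>J. u d * a (unit_fun d) (unit_fun e)) - x None * F (unit_fun e)"
      using fin by (simp add: sum.reindex B_def u_def)
    then show ?thesis
      using x(2) e linear_fun_expand[OF fin u lin(1)] by simp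
  qed
  then have a_u: "a u w = x None * F w" if w: "w \<in> supported J" for w
    unfolding linear_fun_expand[OF fin w lin(2)] linear_fun_expand[OF fin w lin(3)]
    by (simp add: sum_distrib_left mult_ac)
  \<comment> \<open>If the extra component vanished, \<open>u\<close> would lie in the kernel of the
    form, and all components of \<open>x\<close> would be 0.\<close>
  have "x None \<noteq> 0"
  proof
    assume "x None = 0"
    with a_u nondeg[OF u] have "u = (\<lambda>_. 0)"
      by simp
    then have "x (Some d) = 0" if "d \<in> J" for d
      using that by (metis u_def)
    with x(1) \<open>x None = 0\<close> show False
      by auto
  qed
  then have "(\<lambda>d. inverse (x None) * u d) \<in> supported J \<and>
      (\<forall>w\<in>supported J. a (\<lambda>d. inverse (x None) * u d) w = F w)"
    using u a_u lin(1) by (simp add: supported_def linear_fun_def)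
  then show "\<exists>u. u \<in> supported J \<and> (\<forall>w\<in>supported J. a u w = F w)"
    by blast
next
  fix u v
  assume uv: "u \<in> supported J \<and> (\<forall>w\<in>supported J. a u w = F w)" "v \<in> supported J \<and> (\<forall>w\<in>supported J. a v w = F w)"
  have "a (\<lambda>d. u d + - 1 * v d) w = a u w + - 1 *\<^sub>R a v w" for w
    using lin(1)[of w] unfolding linear_fun_def by metis
  with uv have "(\<lambda>d. u d + - 1 * v d) = (\<lambda>_. 0)"
    by (intro nondeg) (auto simp: supported_def)
  then show "u = v"
    by (simp add: fun_eq_iff)
qed

section \<open>The weak formulation\<close>

lemma seg_mass_nonneg: "0 \<le> seg_mass a a' a a'"
proof -
  have "seg_mass a a' a a' = a\<^sup>2 + a'\<^sup>2 + (a + a')\<^sup>2"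
    by (simp add: seg_mass_def power2_eq_square algebra_simps)
  then show ?thesis
    by simp
qed

lemma bnormal_mass_nonneg: "0 \<le> bnormal_mass M X X"
  unfolding bnormal_mass_def by (intro sum_nonneg mult_nonneg_nonneg seg_mass_nonneg) auto

lemma dirichlet_nonneg: "0 \<le> dirichlet M f f"
  unfolding dirichlet_def by (intro sum_nonneg mult_nonneg_nonneg) (simp_all add: tri_area_eq)

lemma lumped_normal_diff:
  "lumped_normal M (\<lambda>x. (X x - Y x) /\<^sub>R \<tau>) \<psi> = (lumped_normal M X \<psi> - lumped_normal M Y \<psi>) / \<tau>"
proof -
  have "a * (((x - y) /\<^sub>R \<tau>) \<bullet> z) = (a * (x \<bullet> z) - a * (y \<bullet> z)) / \<tau>" for a and x y z :: "real^3"
    by (simp add: inner_diff_left divide_inverse algebra_simps)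
  then show ?thesis
    unfolding lumped_normal_def by (simp only: sum_subtractf flip: sum_divide_distrib)
      (simp add: diff_divide_distrib)
qed

lemma bnormal_mass_diff:
  "bnormal_mass M (\<lambda>x. X x - Y x) g = bnormal_mass M X g - bnormal_mass M Y g"
  unfolding bnormal_mass_def seg_mass_def
  by (simp add: inner_diff_left sum_subtractf algebra_simps flip: sum.distrib)

lemma span_planar:
  fixes N :: "(real^3) set"
  assumes "dim N = 2" "\<And>n. n \<in> N \<Longrightarrow> n $ 3 = 0"
  shows "span N = {v. v $ 3 = 0}"
proof -
  have eq: "{v::real^3. v $ 3 = 0} = {v. axis 3 1 \<bullet> v = 0}"
    by (simp add: inner_axis' )
  have "dim {v::real^3. axis 3 1 \<bullet> v = 0} = 2"
    by (subst dim_hyperplane) (auto simp: axis_eq_0_iff)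
  moreover have "subspace {v::real^3. axis 3 1 \<bullet> v = 0}"
    by (rule subspace_hyperplane)
  moreover have "span N \<subseteq> {v. axis 3 1 \<bullet> v = 0}"
    using assms(2) calculation(2) by (intro span_minimal) (auto simp: inner_axis')
  ultimately show ?thesis
    unfolding eq using assms(1) by (intro subspace_dim_equal) simp_all
qed

lemma seg_normal_planar: "seg_normal M j $ 3 = 0"
  by (simp add: seg_normal_def cross3_def e_z_def)

text \<open>The normals span the horizontal plane and thus detect the horizontal part of
  \<open>v\<close>: this part lies in their span and is orthogonal to them, hence to itself.\<close>

lemma orthogonal_seg_normals:
  assumes "dim (seg_normal M ` {1..nseg M}) = 2" "\<And>j. j \<in> {1..nseg M} \<Longrightarrow> v \<bullet> seg_normal M j = 0"
  shows "v $ 1 = 0" "v $ 2 = 0"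
proof -
  define w where "w = v - v $ 3 *\<^sub>R axis 3 1"
  have w: "w $ 1 = v $ 1" "w $ 2 = v $ 2" "w $ 3 = 0"
    by (simp_all add: w_def axis_def)
  have "w \<bullet> seg_normal M j = 0" if "j \<in> {1..nseg M}" for j
    using assms(2)[OF that] by (simp add: w_def inner_diff_left inner_axis' seg_normal_planar)
  moreover have "w \<in> span (seg_normal M ` {1..nseg M})"
    using span_planar[OF assms(1)] w(3) seg_normal_planar by blast
  ultimately have "orthogonal w w"
    by (intro orthogonal_to_span[of w "seg_normal M ` {1..nseg M}"]) (auto simp: orthogonal_def)
  then have "w = 0"
    by (simp add: orthogonal_def)
  then show "v $ 1 = 0" "v $ 2 = 0"
    using w by simp_all
qed

text \<open>The discrete problem is encoded by coordinates \<open>u (d, c)\<close>: for \<open>d = Some i\<close> the \<open>i\<close>-th component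
  of \<open>X\<close> and for \<open>d = None\<close> the value of \<open>H\<close>, at vertex \<open>c\<close>.\<close>

context surface_mesh
begin

text \<open>The third component has no coordinates at vertices on the boundary. Functions supported
  here therefore correspond exactly to the pairs from \<open>fe_vec_space\<close> and
  \<open>fe_space\<close>, for trial and test functions alike.\<close>

definition dofs :: "(3 option \<times> nat) set" where
  "dofs = {(d, c). c \<in> {1..nvert M} \<and> (d = Some 3 \<longrightarrow> vert M c \<notin> bcurve M)}"

definition fe_X :: "(3 option \<times> nat \<Rightarrow> real) \<Rightarrow> real^3 \<Rightarrow> real^3" where
  "fe_X u = interp M (\<lambda>c. \<chi> i. u (Some i, c))"

definition fe_H :: "(3 option \<times> nat \<Rightarrow> real) \<Rightarrow> real^3 \<Rightarrow> real" where
  "fe_H u = interp M (\<lambda>c. u (None, c))"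

lemma finite_dofs: "finite dofs"
  by (rule finite_subset[of _ "UNIV \<times> {1..nvert M}"]) (auto simp: dofs_def)

lemma interp_extensional: "interp M v \<in> extensional (surf M)"
  by (simp add: interp_def)

lemma p1_fe_X: "p1 M (fe_X u)" and p1_fe_H: "p1 M (fe_H u)"
  by (simp_all add: fe_X_def fe_H_def p1_interp)

lemma fe_X_vert: "c \<in> {1..nvert M} \<Longrightarrow> fe_X u (vert M c) $ i = u (Some i, c)"
  and fe_H_vert: "c \<in> {1..nvert M} \<Longrightarrow> fe_H u (vert M c) = u (None, c)"
  by (simp_all add: fe_X_def fe_H_def interp_vert del: atLeastAtMost_iff)

lemma fe_H_in_space: "fe_H u \<in> fe_space M"
  by (simp add: fe_space_iff p1_fe_H) (simp add: fe_H_def interp_extensional)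

lemma fe_X_in_space:
  assumes "u \<in> supported dofs"
  shows "fe_X u \<in> fe_vec_space M"
proof -
  have "fe_X u x $ 3 = 0" if "x \<in> bcurve M" for x
  proof (rule p1_zero_on_bcurve[OF _ _ that])
    show "p1 M (\<lambda>x. fe_X u x $ 3)"
      using p1_fe_X p1_component by blast
    fix c assume c: "c \<in> {1..nvert M}" "vert M c \<in> bcurve M"
    then have "(Some 3, c) \<notin> dofs"
      by (simp add: dofs_def)
    with assms have "u (Some 3, c) = 0"
      by (simp add: supported_def)
    then show "fe_X u (vert M c) $ 3 = 0"
      by (simp add: fe_X_vert[OF c(1)])
  qed
  then show ?thesis
    by (simp add: fe_vec_space_iff p1_fe_X) (simp add: fe_X_def interp_extensional)
qed

text \<open>The coordinates missing from \<open>dofs\<close> at mesh vertices are third components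
  on the boundary, where \<open>X\<close> has third component 0, so the default 0 is the right
  value.\<close>

lemma fe_coordinates:
  assumes "X \<in> fe_vec_space M" "H \<in> fe_space M"
  obtains u where "u \<in> supported dofs" "fe_X u = X" "fe_H u = H"
proof -
  define u where "u = (\<lambda>(d, c). if (d, c) \<in> dofs then (case d of None \<Rightarrow> H (vert M c) | Some i \<Rightarrow> X (vert M c) $ i) else 0)"
  have u: "u \<in> supported dofs"
    by (auto simp: u_def supported_def)
  have "fe_X u (vert M c) $ i = X (vert M c) $ i" if "c \<in> {1..nvert M}" for c i
  proof (cases "(Some i, c) \<in> dofs")
    case False
    then have "i = 3" "vert M c \<in> bcurve M"
      using that by (auto simp: dofs_def)
    with False show ?thesis
      using assms(1) by (simp add: fe_X_vert[OF that] u_def fe_vec_space_iff)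
  qed (simp add: fe_X_vert[OF that] u_def)
  then have X: "fe_X u = X"
    using assms(1) by (intro p1_eqI p1_fe_X)
      (simp_all add: fe_vec_space_iff fe_X_def interp_extensional vec_eq_iff del: atLeastAtMost_iff)
  have "fe_H u (vert M c) = H (vert M c)" if "c \<in> {1..nvert M}" for c
    using that by (simp add: fe_H_vert[OF that] u_def dofs_def)
  then have "fe_H u = H"
    using assms(2) by (intro p1_eqI p1_fe_H)
      (simp_all add: fe_space_iff fe_H_def interp_extensional del: atLeastAtMost_iff)
  with u X that show thesis
    by blast
qed

section \<open>Linearity of the nodal expressions in the coordinates\<close>

lemma linear_fun_interp:
  assumes "x \<in> surf M" "\<And>c. linear_fun (\<lambda>u. v u c)"
  shows "linear_fun (\<lambda>u. interp M (v u) x)"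
proof -
  obtain j where "j \<in> {1..ntri M}" "x \<in> closed_tri M j"
    using assms(1) by (auto simp: surf_eq)
  then show ?thesis
    by (simp add: interp_eq local_interp_def) (intro linear_fun_intros assms(2))
qed

lemma linear_fun_fe_X: "x \<in> surf M \<Longrightarrow> linear_fun (\<lambda>u. fe_X u x)"
  unfolding fe_X_def by (intro linear_fun_interp linear_fun_intros)

lemma linear_fun_fe_H: "x \<in> surf M \<Longrightarrow> linear_fun (\<lambda>u. fe_H u x)"
  unfolding fe_H_def by (intro linear_fun_interp linear_fun_intros)

lemma linear_fun_lumped_normal_left:
  "linear_fun (\<lambda>u. lumped_normal M (fe_X u) \<psi>)"
  unfolding lumped_normal_def by (intro linear_fun_intros linear_fun_fe_X tri_pt_in_surf)

lemma linear_fun_lumped_normal_right: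
  "linear_fun (\<lambda>u. lumped_normal M X (fe_H u))"
  unfolding lumped_normal_def by (intro linear_fun_intros linear_fun_fe_H tri_pt_in_surf)

lemma linear_fun_dirichlet:
  assumes "\<And>x. x \<in> surf M \<Longrightarrow> linear_fun (\<lambda>u. f u x)"
  shows "linear_fun (\<lambda>u. dirichlet M (f u) g)" "linear_fun (\<lambda>u. dirichlet M g (f u))"
  unfolding dirichlet_def tri_grad_def by (intro linear_fun_intros assms tri_pt_in_surf; assumption)+

lemma seg_pt_in_surf: "j \<in> {1..nseg M} \<Longrightarrow> seg_pt M j 1 \<in> surf M" "j \<in> {1..nseg M} \<Longrightarrow> seg_pt M j 2 \<in> surf M"
  using seg_pt_in_bcurve bcurve_subset_surf by blast+

lemma linear_fun_bnormal_mass: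
  "linear_fun (\<lambda>u. bnormal_mass M (fe_X u) Y)" "linear_fun (\<lambda>u. bnormal_mass M Y (fe_X u))"
  unfolding bnormal_mass_def seg_mass_def
  by (intro linear_fun_intros linear_fun_fe_X seg_pt_in_surf; assumption)+

text \<open>All gradients vanish, so \<open>f\<close> is constant on each triangle and has finite
  range. A continuous function with finite range on a connected set is constant; no chain of
  neighbouring triangles has to be followed.\<close>

lemma dirichlet_eq_0_imp_constant:
  assumes "connected (surf M)" "p1 M f" "dirichlet M f f = 0"
  shows "\<exists>c. \<forall>x\<in>surf M. f x = c"
proof -
  have grad: "tri_grad M f j = 0" if j: "j \<in> {1..ntri M}" for j
  proof -
    have "tri_area M j * (tri_grad M f j \<bullet> tri_grad M f j) = 0"
      using assms(3) j unfolding dirichlet_def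
      by (subst (asm) sum_nonneg_eq_0_iff) (auto simp: tri_area_eq)
    then show ?thesis
      using nondegenerate[OF j] by (simp add: tri_area_eq)
  qed
  have "f x = f (tri_pt M j 1)" if j: "j \<in> {1..ntri M}" and "x \<in> closed_tri M j" for x j
    using p1_increment[OF assms(2) j tri_pt_in_closed_tri that(2), of 1] grad[OF j] by simp
  then have "f ` surf M \<subseteq> (\<lambda>j. f (tri_pt M j 1)) ` {1..ntri M}"
    unfolding surf_eq by blast
  then have "finite (f ` surf M)"
    by (rule finite_subset) simp
  from continuous_finite_range_constant[OF assms(1) continuous_on_p1[OF assms(2)] this]
  show ?thesis
    by (auto simp: constant_on_def)
qed

lemma adjacent_tris_eq: "c \<in> {1..nvert M} \<Longrightarrow> adjacent_tris M c = {j \<in> {1..ntri M}. c \<in> tri_verts j}"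
  unfolding adjacent_tris_def closure_open_tri using vert_in_closed_tri by blast

text \<open>A triangle contributes only if \<open>c\<close> is one of its corners, and then exactly
  once since its corners are distinct. What remains is the numerator of the weighted normal at
  \<open>c\<close>; the factor 1/3 stems from mass lumping.\<close>

lemma lumped_normal_nodal:
  assumes c: "c \<in> {1..nvert M}"
    and X: "\<And>b. b \<in> {1..nvert M} \<Longrightarrow> X (vert M b) = (if b = c then v else 0)"
    and H: "\<And>x. x \<in> surf M \<Longrightarrow> H x = h"
  shows "lumped_normal M X H = h / 3 * (v \<bullet> (\<Sum>j\<in>adjacent_tris M c. tri_area M j *\<^sub>R tri_normal M j))"
proof -
  have "(\<Sum>k=1..3. tri_area M j * (X (tri_pt M j k) \<bullet> (H (tri_pt M j k) *\<^sub>R tri_normal M j))) =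
      (if c \<in> tri_verts j then h * (v \<bullet> (tri_area M j *\<^sub>R tri_normal M j)) else 0)"
    if j: "j \<in> {1..ntri M}" for j
  proof -
    have "X (tri_pt M j k) = (if tri M j k = c then v else 0)" if "k \<in> {1..3}" for k
      unfolding tri_pt_def by (intro X tri_in_range j that)
    then have "(\<Sum>k=1..3. tri_area M j * (X (tri_pt M j k) \<bullet> (H (tri_pt M j k) *\<^sub>R tri_normal M j))) =
        (\<Sum>k=1..3. if tri M j k = c then h * (v \<bullet> (tri_area M j *\<^sub>R tri_normal M j)) else 0)"
      using H tri_pt_in_surf[OF j] by (intro sum.cong) (simp_all del: atLeastAtMost_iff)
    also have "\<dots> = (\<Sum>b\<in>tri_verts j. if b = c then h * (v \<bullet> (tri_area M j *\<^sub>R tri_normal M j)) else 0)"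
      by (simp add: sum.reindex[OF inj_on_tri[OF j]])
    finally show ?thesis
      by simp
  qed
  then have "lumped_normal M X H =
      1/3 * (\<Sum>j=1..ntri M. if c \<in> tri_verts j then h * (v \<bullet> (tri_area M j *\<^sub>R tri_normal M j)) else 0)"
    unfolding lumped_normal_def by (simp del: atLeastAtMost_iff)
  also have "\<dots> = 1/3 * (\<Sum>j\<in>adjacent_tris M c. h * (v \<bullet> (tri_area M j *\<^sub>R tri_normal M j)))"
    unfolding adjacent_tris_eq[OF c] by (subst sum.inter_filter[symmetric]) simp_all
  finally show ?thesis
    by (simp add: inner_sum_right sum_distrib_left)
qed

text \<open>The left-hand side of \<tau> times the first equation minus the second, with \<gamma>
  standing for \<open>1 / (\<eta> * \<tau>)\<close>. This sign makes the lumped part antisymmetric;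
  the rest is symmetric, and positive semidefinite for positive \<tau> and \<gamma>.\<close>

definition form :: "real \<Rightarrow> real \<Rightarrow> (3 option \<times> nat \<Rightarrow> real) \<Rightarrow> (3 option \<times> nat \<Rightarrow> real) \<Rightarrow> real" where
  "form \<tau> \<gamma> u w =
     lumped_normal M (fe_X u) (fe_H w) + \<tau> * dirichlet M (fe_H u) (fe_H w)
     - lumped_normal M (fe_X w) (fe_H u)
     + (\<Sum>i\<in>UNIV. dirichlet M (\<lambda>x. fe_X u x $ i) (\<lambda>x. fe_X w x $ i))
     + \<gamma> * bnormal_mass M (fe_X u) (fe_X w)"

definition load :: "real \<Rightarrow> (3 option \<times> nat \<Rightarrow> real) \<Rightarrow> real" where
  "load \<gamma> w = lumped_normal M (surf_id M) (fe_H w) + \<gamma> * bnormal_mass M (surf_id M) (fe_X w)"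

lemma linear_fun_form: "linear_fun (\<lambda>u. form \<tau> \<gamma> u w)" "linear_fun (form \<tau> \<gamma> u)"
proof -
  have "linear_fun (\<lambda>u. \<Sum>i\<in>UNIV. dirichlet M (\<lambda>x. fe_X u x $ i) (\<lambda>x. fe_X w x $ i))"
    by (intro linear_fun_sum linear_fun_dirichlet(1) linear_fun_vec_nth linear_fun_fe_X)
  then show "linear_fun (\<lambda>u. form \<tau> \<gamma> u w)"
    unfolding form_def
    by (intro linear_fun_add linear_fun_diff linear_fun_mult_right linear_fun_lumped_normal_left
        linear_fun_lumped_normal_right linear_fun_dirichlet(1) linear_fun_bnormal_mass linear_fun_fe_H)
  have "linear_fun (\<lambda>w. \<Sum>i\<in>UNIV. dirichlet M (\<lambda>x. fe_X u x $ i) (\<lambda>x. fe_X w x $ i))"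
    by (intro linear_fun_sum linear_fun_dirichlet(2) linear_fun_vec_nth linear_fun_fe_X)
  then show "linear_fun (form \<tau> \<gamma> u)"
    unfolding form_def
    by (intro linear_fun_add linear_fun_diff linear_fun_mult_right linear_fun_lumped_normal_left
        linear_fun_lumped_normal_right linear_fun_dirichlet(2) linear_fun_bnormal_mass linear_fun_fe_H)
qed

lemma linear_fun_load: "linear_fun (load \<gamma>)"
  unfolding load_def
  by (intro linear_fun_add linear_fun_mult_right linear_fun_lumped_normal_right linear_fun_bnormal_mass)

text \<open>Testing with \<open>w = u\<close> cancels the two lumped terms, so the remaining nonnegative terms vanish.\<close>

lemma form_energy:
  assumes "\<tau> > 0" "\<gamma> > 0" "form \<tau> \<gamma> u u = 0"
  shows "dirichlet M (fe_H u) (fe_H u) = 0" "dirichlet M (\<lambda>x. fe_X u x $ i) (\<lambda>x. fe_X u x $ i) = 0"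
    "bnormal_mass M (fe_X u) (fe_X u) = 0"
proof -
  let ?A = "dirichlet M (fe_H u) (fe_H u)"
  let ?B = "\<Sum>i\<in>UNIV. dirichlet M (\<lambda>x. fe_X u x $ i) (\<lambda>x. fe_X u x $ i)"
  let ?C = "bnormal_mass M (fe_X u) (fe_X u)"
  have sum: "\<tau> * ?A + ?B + \<gamma> * ?C = 0"
    using assms(3) by (simp add: form_def)
  have nonneg: "0 \<le> \<tau> * ?A" "0 \<le> ?B" "0 \<le> \<gamma> * ?C"
    using assms(1,2) by (simp_all add: dirichlet_nonneg bnormal_mass_nonneg sum_nonneg)
  have "\<tau> * ?A = 0" "?B = 0" "\<gamma> * ?C = 0"
    using sum nonneg by linarith+
  then show "?A = 0" "?C = 0" "dirichlet M (\<lambda>x. fe_X u x $ i) (\<lambda>x. fe_X u x $ i) = 0"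
    using assms(1,2) by (simp_all add: sum_nonneg_eq_0_iff dirichlet_nonneg)
qed

text \<open>For constant \<open>X\<close> the summand of segment \<open>j\<close> is its length
  times the square of \<open>v \<bullet> seg_normal M j\<close>, and nonnegative summands with sum 0
  vanish one by one.\<close>

lemma bnormal_mass_constant_eq_0:
  assumes "bnormal_mass M X X = 0" "\<And>x. x \<in> surf M \<Longrightarrow> X x = v" "j \<in> {1..nseg M}"
  shows "v \<bullet> seg_normal M j = 0"
proof -
  have "norm (seg_pt M j 2 - seg_pt M j 1) / 6 *
     seg_mass (X (seg_pt M j 1) \<bullet> seg_normal M j) (X (seg_pt M j 2) \<bullet> seg_normal M j)
              (X (seg_pt M j 1) \<bullet> seg_normal M j) (X (seg_pt M j 2) \<bullet> seg_normal M j) = 0"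
    using assms(1,3) unfolding bnormal_mass_def
    by (subst (asm) sum_nonneg_eq_0_iff) (auto simp: seg_mass_nonneg)
  then have "seg_mass (v \<bullet> seg_normal M j) (v \<bullet> seg_normal M j) (v \<bullet> seg_normal M j) (v \<bullet> seg_normal M j) = 0"
    using seg_pt_neq[OF assms(3)] assms(2) seg_pt_in_surf[OF assms(3)] by simp
  then show ?thesis
    by (simp add: seg_mass_def)
qed

lemma form_nondegenerate:
  assumes "connected (surf M)" "\<tau> > 0" "\<gamma> > 0" "dim (seg_normal M ` {1..nseg M}) = 2"
    and k: "k \<in> {1..nvert M}" "vert M k \<in> bcurve M"
      "0 < (weighted_normal M k $ 1)\<^sup>2 + (weighted_normal M k $ 2)\<^sup>2"
    and u: "u \<in> supported dofs" "\<And>w. w \<in> supported dofs \<Longrightarrow> form \<tau> \<gamma> u w = 0"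
  shows "u = (\<lambda>_. 0)"
proof -
  note energy = form_energy[OF assms(2,3) u(2)[OF u(1)]]
  obtain h where h: "\<forall>x\<in>surf M. fe_H u x = h"
    using dirichlet_eq_0_imp_constant[OF assms(1) p1_fe_H energy(1)] by blast
  have "\<forall>i. \<exists>c. \<forall>x\<in>surf M. fe_X u x $ i = c"
    using dirichlet_eq_0_imp_constant[OF assms(1) _ energy(2)] p1_fe_X p1_component by blast
  then obtain f where "\<forall>i. \<forall>x\<in>surf M. fe_X u x $ i = f i"
    by metis
  then obtain v :: "real^3" where v: "\<And>x. x \<in> surf M \<Longrightarrow> fe_X u x = v"
    using that[of "\<chi> i. f i"] by (auto simp: vec_eq_iff)
  have vert_surf: "vert M c \<in> surf M" if "c \<in> {1..nvert M}" for c
  proof -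
    obtain j l where "j \<in> {1..ntri M}" "l \<in> {1..3}" "c = tri M j l"
      using \<open>c \<in> {1..nvert M}\<close> Union_tri_verts by blast
    then show ?thesis
      using tri_pt_in_surf[of j M l] by (simp add: tri_pt_def)
  qed
  have "v \<bullet> seg_normal M j = 0" if "j \<in> {1..nseg M}" for j
    by (rule bnormal_mass_constant_eq_0[OF energy(3) v that])
  then have "v $ 1 = 0" "v $ 2 = 0"
    using orthogonal_seg_normals[OF assms(4)] by blast+
  \<comment> \<open>The normals leave the vertical component open; it is read off at the boundary
    vertex \<open>k\<close>, where the third component of the field vanishes.\<close>
  moreover have "v $ 3 = 0"
    using fe_X_in_space[OF u(1)] v[OF vert_surf[OF k(1)]] k(2) by (auto simp: fe_vec_space_iff)
  ultimately have v0: "v = 0"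
    by (simp add: vec_eq_iff forall_3)
  define \<omega> where "\<omega> = weighted_normal M k"
  \<comment> \<open>The vertical component is dropped because a test field has none at a boundary
    vertex. The product with the full weighted normal is then the sum of squares assumed
    positive.\<close>
  define \<omega>' :: "real^3" where "\<omega>' = (\<chi> i. if i = 3 then 0 else \<omega> $ i)"
  define w where "w = (\<lambda>(d, c). if c = k then (case d of None \<Rightarrow> 0 | Some i \<Rightarrow> \<omega>' $ i) else 0)"
  have w: "w \<in> supported dofs"
    using k(1) by (auto simp: w_def supported_def dofs_def \<omega>'_def split: option.splits)
  have X_w: "fe_X w (vert M c) = (if c = k then \<omega>' else 0)" if "c \<in> {1..nvert M}" for c
    by (simp add: vec_eq_iff fe_X_vert[OF that] w_def)
  define S where "S = (\<Sum>j\<in>adjacent_tris M k. tri_area M j *\<^sub>R tri_normal M j)"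
  define A where "A = (\<Sum>j\<in>adjacent_tris M k. tri_area M j)"
  have \<omega>: "\<omega> = S /\<^sub>R A"
    by (simp add: \<omega>_def weighted_normal_def S_def A_def)
  have pos: "\<omega>' \<bullet> \<omega> > 0"
    using k(3) by (simp add: inner_vec_def sum_3 \<omega>'_def power2_eq_square flip: \<omega>_def)
  \<comment> \<open>Since \<omega> is a multiple of \<open>S\<close>, a vanishing product with
    \<open>S\<close> would make the product with \<omega> vanish.\<close>
  then have "\<omega>' \<bullet> S \<noteq> 0"
    by (auto simp: \<omega>)
  have "lumped_normal M (fe_X u) (fe_H w) = 0"
    using v v0 tri_pt_in_surf by (simp add: lumped_normal_def del: atLeastAtMost_iff)
  moreover have "dirichlet M (fe_H u) g = 0" for g
  proof -
    have "tri_grad M (fe_H u) j = 0" if "j \<in> {1..ntri M}" for j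
      using h tri_pt_in_surf[OF that] sum_bary_grad[of M j]
      by (simp add: tri_grad_def flip: scaleR_sum_right del: atLeastAtMost_iff)
    then show ?thesis
      by (simp add: dirichlet_def del: atLeastAtMost_iff)
  qed
  moreover have "dirichlet M (\<lambda>x. fe_X u x $ i) g = 0" for g i
    using v v0 tri_pt_in_surf by (simp add: dirichlet_def tri_grad_def del: atLeastAtMost_iff)
  moreover have "bnormal_mass M (fe_X u) g = 0" for g
    using v v0 seg_pt_in_surf by (simp add: bnormal_mass_def seg_mass_def del: atLeastAtMost_iff)
  ultimately have "lumped_normal M (fe_X w) (fe_H u) = 0"
    using u(2)[OF w] by (simp add: form_def)
  then have "h / 3 * (\<omega>' \<bullet> S) = 0"
    using lumped_normal_nodal[OF k(1) X_w, of "fe_H u" h] h by (simp add: S_def)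
  with \<open>\<omega>' \<bullet> S \<noteq> 0\<close> have "h = 0"
    by simp
  show ?thesis
  proof
    fix e :: "3 option \<times> nat"
    obtain d c where e: "e = (d, c)"
      by (cases e)
    show "u e = 0"
    proof (cases "e \<in> dofs")
      case True
      then have c: "c \<in> {1..nvert M}"
        by (simp add: e dofs_def)
      show ?thesis
      proof (cases d)
        case None
        then show ?thesis
          using fe_H_vert[OF c, of u] h \<open>h = 0\<close> vert_surf[OF c] by (simp add: e)
      next
        case (Some i)
        then show ?thesis
          using fe_X_vert[OF c, of u i] v[OF vert_surf[OF c]] v0 by (simp add: e)
      qed
    next
      case False
      then show ?thesis
        using u(1) unfolding supported_def by blast
    qed
  qed
qed

text \<open>The scalar and the vector test function vary independently, so setting one of them to 0
  in the combined identity isolates the equation of the other.\<close>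

lemma weak_system_iff:
  fixes \<tau> \<eta> \<theta> :: real
  assumes "\<tau> > 0" "\<eta> > 0" "cos \<theta> = 0" and u: "u \<in> supported dofs"
  shows "((\<forall>\<psi>\<in>fe_space M.
       lumped_prod M (\<lambda>x. (fe_X u x - surf_id M x) /\<^sub>R \<tau>) (\<lambda>x. \<psi> x *\<^sub>R normal M x)
       + surf_prod M (surf_grad M (fe_H u)) (surf_grad M \<psi>) = 0) \<and>
    (\<forall>g\<in>fe_vec_space M.
       lumped_prod M (\<lambda>x. fe_H u x *\<^sub>R normal M x) g
       - surf_prod M (surf_grad_vec M (fe_X u)) (surf_grad_vec M g)
       + cos \<theta> * bcurve_prod M (bnormal_half M (btrace M (surf_id M)) (btrace M (fe_X u))) g
       - 1 / (\<eta> * \<tau>) *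
           bcurve_prod M (\<lambda>x. (btrace M (fe_X u) x - btrace M (surf_id M) x) \<bullet> bnormal M x)
                         (\<lambda>x. g x \<bullet> bnormal M x) = 0)) \<longleftrightarrow>
    (\<forall>w\<in>supported dofs. form \<tau> (1 / (\<eta> * \<tau>)) u w = load (1 / (\<eta> * \<tau>)) w)"
    (is "(\<forall>\<psi>\<in>_. ?E1 \<psi> = 0) \<and> (\<forall>g\<in>_. ?E2 g = 0) \<longleftrightarrow> ?R")
proof -
  define \<gamma> where "\<gamma> = 1 / (\<eta> * \<tau>)"
  have E1: "?E1 \<psi> = (lumped_normal M (fe_X u) \<psi> - lumped_normal M (surf_id M) \<psi>) / \<tau> + dirichlet M (fe_H u) \<psi>"
    if "\<psi> \<in> fe_space M" for \<psi>
  proof -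
    have \<psi>: "p1 M \<psi>"
      using that by (simp add: fe_space_iff)
    have "p1 M (\<lambda>x. (fe_X u x - surf_id M x) /\<^sub>R \<tau>)"
      by (intro p1_linear[OF linear_scaleR] p1_diff p1_fe_X p1_surf_id)
    then show ?thesis
      by (simp only: lumped_prod_normal_right \<psi> surf_prod_surf_grad p1_fe_H lumped_normal_diff)
  qed
  have E2: "?E2 g = lumped_normal M g (fe_H u)
      - (\<Sum>i\<in>UNIV. dirichlet M (\<lambda>x. fe_X u x $ i) (\<lambda>x. g x $ i))
      - \<gamma> * (bnormal_mass M (fe_X u) g - bnormal_mass M (surf_id M) g)"
    if "g \<in> fe_vec_space M" for g
  proof -
    have g: "p1 M g"
      using that by (simp add: fe_vec_space_iff)
    have "bcurve_prod M (\<lambda>x. (btrace M (fe_X u) x - btrace M (surf_id M) x) \<bullet> bnormal M x)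
          (\<lambda>x. g x \<bullet> bnormal M x) =
        bcurve_prod M (\<lambda>x. (fe_X u x - surf_id M x) \<bullet> bnormal M x) (\<lambda>x. g x \<bullet> bnormal M x)"
      by (intro bcurve_prod_cong) (simp_all add: btrace_def)
    also have "\<dots> = bnormal_mass M (\<lambda>x. fe_X u x - surf_id M x) g"
      by (intro bcurve_prod_bnormal p1_diff p1_fe_X p1_surf_id g)
    \<comment> \<open>Here \<open>cos \<theta> = 0\<close> removes the term with
      \<open>bnormal_half\<close>, which involves the unknown.\<close>
    finally show ?thesis
      by (simp add: lumped_prod_normal_left p1_fe_H p1_fe_X g surf_prod_surf_grad_vec assms(3)
          bnormal_mass_diff \<gamma>_def)
  qed
  have combined: "form \<tau> \<gamma> u w - load \<gamma> w = \<tau> * ?E1 (fe_H w) - ?E2 (fe_X w)" if "w \<in> supported dofs" for w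
    unfolding E1[OF fe_H_in_space] E2[OF fe_X_in_space[OF that]]
    using assms(1) by (simp add: form_def load_def field_simps)
  have "(\<forall>\<psi>\<in>fe_space M. ?E1 \<psi> = 0) \<and> (\<forall>g\<in>fe_vec_space M. ?E2 g = 0) \<longleftrightarrow>
      (\<forall>w\<in>supported dofs. form \<tau> \<gamma> u w = load \<gamma> w)"
  proof (intro iffI conjI ballI)
    fix w assume "(\<forall>\<psi>\<in>fe_space M. ?E1 \<psi> = 0) \<and> (\<forall>g\<in>fe_vec_space M. ?E2 g = 0)" and w: "w \<in> supported dofs"
    then have "?E1 (fe_H w) = 0" "?E2 (fe_X w) = 0"
      using fe_H_in_space fe_X_in_space[OF w] by blast+
    then show "form \<tau> \<gamma> u w = load \<gamma> w"
      using combined[OF w] by simp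
  next
    fix \<psi> assume R: "\<forall>w\<in>supported dofs. form \<tau> \<gamma> u w = load \<gamma> w" and \<psi>: "\<psi> \<in> fe_space M"
    have 0: "(\<lambda>_. 0) \<in> supported dofs"
      by (simp add: supported_def)
    \<comment> \<open>The zero field is taken as \<open>fe_X (\<lambda>_. 0)\<close> because
      elements of the space are extensional on the surface.\<close>
    obtain w where w: "w \<in> supported dofs" "fe_X w = fe_X (\<lambda>_. 0)" "fe_H w = \<psi>"
      using fe_coordinates[OF fe_X_in_space[OF 0] \<psi>] .
    have "linear_fun (\<lambda>w. \<Sum>i\<in>UNIV. dirichlet M (\<lambda>x. fe_X u x $ i) (\<lambda>x. fe_X w x $ i))"
      by (intro linear_fun_sum linear_fun_dirichlet(2) linear_fun_vec_nth linear_fun_fe_X)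
    note zero = linear_fun_zero[OF this] linear_fun_lumped_normal_left[THEN linear_fun_zero]
      linear_fun_bnormal_mass(2)[THEN linear_fun_zero]
    have "?E2 (fe_X (\<lambda>_. 0)) = 0"
      unfolding E2[OF fe_X_in_space[OF 0]] by (simp add: zero)
    then have "\<tau> * ?E1 \<psi> = 0"
      using combined[OF w(1)] R w by simp
    then show "?E1 \<psi> = 0"
      using assms(1) by simp
  next
    fix g assume R: "\<forall>w\<in>supported dofs. form \<tau> \<gamma> u w = load \<gamma> w" and g: "g \<in> fe_vec_space M"
    obtain w where w: "w \<in> supported dofs" "fe_X w = g" "fe_H w = fe_H (\<lambda>_. 0)"
      using fe_coordinates[OF g fe_H_in_space] .
    note zero = linear_fun_lumped_normal_right[THEN linear_fun_zero]
      linear_fun_dirichlet(2)[OF linear_fun_fe_H, THEN linear_fun_zero]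
    have "?E1 (fe_H (\<lambda>_. 0)) = 0"
      unfolding E1[OF fe_H_in_space] by (simp add: zero)
    then show "?E2 g = 0"
      using combined[OF w(1)] R w by simp
  qed
  then show ?thesis
    by (simp only: \<gamma>_def)
qed

end

theorem theorem3p1:
  fixes M :: mesh and \<tau> \<eta> \<theta>\<^sub>Y :: real
  assumes "0 < \<tau>" and "0 < \<eta>"
    and "polygonal_surface M"
    and "connected (surf M)"
    and "0 < (MIN j\<in>{1..ntri M}. tri_area M j)"
    and "dim (seg_normal M ` {1..nseg M}) = 2"
    and "\<exists>k\<^sub>0\<in>{1..nvert M}. vert M k\<^sub>0 \<in> bcurve M \<and>
           0 < (weighted_normal M k\<^sub>0 $ 1)\<^sup>2 + (weighted_normal M k\<^sub>0 $ 2)\<^sup>2"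
    and "cos \<theta>\<^sub>Y = 0"
  shows "\<exists>!(X, H).
    X \<in> fe_vec_space M \<and> H \<in> fe_space M \<and>
    (\<forall>\<psi>\<in>fe_space M.
       lumped_prod M (\<lambda>x. (X x - surf_id M x) /\<^sub>R \<tau>) (\<lambda>x. \<psi> x *\<^sub>R normal M x)
       + surf_prod M (surf_grad M H) (surf_grad M \<psi>) = 0) \<and>
    (\<forall>g\<in>fe_vec_space M.
       lumped_prod M (\<lambda>x. H x *\<^sub>R normal M x) g
       - surf_prod M (surf_grad_vec M X) (surf_grad_vec M g)
       + cos \<theta>\<^sub>Y * bcurve_prod M (bnormal_half M (btrace M (surf_id M)) (btrace M X)) g
       - 1 / (\<eta> * \<tau>) *
           bcurve_prod M (\<lambda>x. (btrace M X x - btrace M (surf_id M) x) \<bullet> bnormal M x)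
                         (\<lambda>x. g x \<bullet> bnormal M x) = 0)"
    (is "\<exists>!(X, H). X \<in> _ \<and> H \<in> _ \<and> ?E1 X H \<and> ?E2 X H")
proof -
  \<comment> \<open>The area is half the norm of the cross product, so a positive minimum of the
    areas makes every triangle nondegenerate.\<close>
  have "tri_cross M j \<noteq> 0" if j: "j \<in> {1..ntri M}" for j
  proof -
    have "(MIN j\<in>{1..ntri M}. tri_area M j) \<le> tri_area M j"
      using j by (intro Min_le) auto
    then show ?thesis
      using assms(5) by (auto simp: tri_area_eq)
  qed
  then interpret surface_mesh M
    using assms(3) by unfold_locales (auto simp: polygonal_surface_def)
  define \<gamma> where "\<gamma> = 1 / (\<eta> * \<tau>)"
  have "\<gamma> > 0"
    using assms(1,2) by (simp add: \<gamma>_def)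
  obtain k where k: "k \<in> {1..nvert M}" "vert M k \<in> bcurve M"
      "0 < (weighted_normal M k $ 1)\<^sup>2 + (weighted_normal M k $ 2)\<^sup>2"
    using assms(7) by blast
  have "\<exists>!u. u \<in> supported dofs \<and> (\<forall>w\<in>supported dofs. form \<tau> \<gamma> u w = load \<gamma> w)"
    by (intro nondegenerate_form_solvable finite_dofs linear_fun_form linear_fun_load
        form_nondegenerate[OF assms(4,1) \<open>\<gamma> > 0\<close> assms(6) k])
  moreover have "u \<in> supported dofs \<and> ?E1 (fe_X u) (fe_H u) \<and> ?E2 (fe_X u) (fe_H u) \<longleftrightarrow>
      u \<in> supported dofs \<and> (\<forall>w\<in>supported dofs. form \<tau> \<gamma> u w = load \<gamma> w)" for u
    unfolding \<gamma>_def by (rule conj_cong[OF refl weak_system_iff[OF assms(1,2,8)]])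
  ultimately have "\<exists>!u. u \<in> supported dofs \<and> ?E1 (fe_X u) (fe_H u) \<and> ?E2 (fe_X u) (fe_H u)"
    by (simp only:)
  then obtain u where u: "u \<in> supported dofs \<and> ?E1 (fe_X u) (fe_H u) \<and> ?E2 (fe_X u) (fe_H u)"
    and unique: "\<forall>v. v \<in> supported dofs \<and> ?E1 (fe_X v) (fe_H v) \<and> ?E2 (fe_X v) (fe_H v) \<longrightarrow> v = u"
    by (rule ex1E)
  show ?thesis
  proof (rule ex1I[of _ "(fe_X u, fe_H u)"], unfold split_paired_all prod.case)
    show "fe_X u \<in> fe_vec_space M \<and> fe_H u \<in> fe_space M \<and> ?E1 (fe_X u) (fe_H u) \<and> ?E2 (fe_X u) (fe_H u)"
      using u fe_X_in_space fe_H_in_space by blast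
    fix X H
    assume XH: "X \<in> fe_vec_space M \<and> H \<in> fe_space M \<and> ?E1 X H \<and> ?E2 X H"
    \<comment> \<open>Every pair in the two spaces has coordinates, so uniqueness passes from
      coordinates to pairs.\<close>
    then obtain v where v: "v \<in> supported dofs" "fe_X v = X" "fe_H v = H"
      using fe_coordinates by blast
    have "v = u"
      by (rule unique[rule_format], unfold v(2,3)) (use v(1) XH in blast)
    then show "(X, H) = (fe_X u, fe_H u)"
      using v by simp
  qed
qed

end
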